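(* Let $\mathbb H$ be the Heisenberg group and let $d_F$ be the Finsler distance on $\mathbb H$ associated with the left-invariant Finsler structure whose norm on the Lie algebra $\mathfrak h=\mathrm{span}\{X,Y,Z\}$ is $$\lVert v\rVert=\max\left\{\sqrt{\rho(v_h,v_h)},\lvert\lambda\rvert\right\},\qquad v=v_h+\lambda Z,\ v_h\in\mathrm{span}\{X,Y\},\ \lambda\in\mathbb R,$$ where $\rho$ is the inner product on $\mathrm{span}\{X,Y\}$ for which $\{X,Y\}$ is orthonormal. Then there are no Carnot metrics $d$ on $\mathbb H$ such that $$\lvert d(p,q)-d_F(p,q)\rvert\to 0\quad\text{as }d(p,q)\to\infty.$$
   Context: The Heisenberg Lie algebra $\mathfrak h$ has basis $\{X,Y,Z\}$ with only non-trivial bracket $[X,Y]=Z$; the Heisenberg group is $\mathbb H=(\mathfrak h,* )$ with $x*y=x+y+\frac12[x,y]$. The Finsler distance associated with a norm $\lVert\cdot\rVert$ on $\mathfrak h$ is $d_F(p,q)=\inf\int_0^1\lVert (dL_{\gamma(t)})^{-1}\dot\gamma(t)\rVert\,dt$ over absolutely continuous curves $\gamma:[0,1]\to\mathbb H$ from $p$ to $q$. A Carnot metric on a simply connected nilpotent Lie group $G$ is a left-invariant length distance obtained from a stratification $\mathfrak g=V_1\oplus\dots\oplus V_s$ ($[V_1,V_i]=V_{i+1}$, $V_{s+1}=0$) and a norm $N$ on $V_1$: $d(p,q)$ is the infimum of $\int_0^1N((dL_{\gamma(t)})^{-1}\dot\gamma(t))\,dt$ over absolutely continuous curves $\gamma$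 from $p$ to $q$ with $(dL_{\gamma(t)})^{-1}\dot\gamma(t)\in V_1$ for a.e. $t$. *)

theory Defs
  imports "HOL-Analysis.Analysis"
begin

text \<open>
  The Heisenberg Lie algebra is realised on \<^typ>\<open>real ^ 3\<close>, with coordinates with respect to
  the basis \<open>X, Y, Z\<close>.  The Heisenberg group has the same underlying set; its identity is \<open>0\<close>.
\<close>

type_synonym heis = "real ^ 3"

definition X :: heis where "X = axis 1 1"
definition Y :: heis where "Y = axis 2 1"
definition Z :: heis where "Z = axis 3 1"

definition lie_bracket :: "heis \<Rightarrow> heis \<Rightarrow> heis" where
  "lie_bracket v w = (v $ 1 * w $ 2 - v $ 2 * w $ 1) *\<^sub>R Z"

definition heis_mult :: "heis \<Rightarrow> heis \<Rightarrow> heis" where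
  "heis_mult x y = x + y + (1 / 2) *\<^sub>R lie_bracket x y"

text \<open>Differential at the identity of the left translation by \<open>p\<close>.\<close>

definition dL :: "heis \<Rightarrow> heis \<Rightarrow> heis" where
  "dL p = frechet_derivative (heis_mult p) (at 0)"

definition absolutely_continuous_curve :: "(real \<Rightarrow> heis) \<Rightarrow> bool" where
  "absolutely_continuous_curve \<gamma> \<longleftrightarrow>
     (\<forall>\<epsilon>>0. \<exists>\<delta>>0. \<forall>(n::nat) (a :: nat \<Rightarrow> real) (b :: nat \<Rightarrow> real).
        (\<forall>i<n. 0 \<le> a i \<and> a i \<le> b i \<and> b i \<le> 1) \<longrightarrow>
        disjoint_family_on (\<lambda>i. {a i<..<b i}) {..<n} \<longrightarrow>
        (\<Sum>i<n. b i - a i) < \<delta> \<longrightarrow>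
        (\<Sum>i<n. dist (\<gamma> (a i)) (\<gamma> (b i))) < \<epsilon>)"

text \<open>The vector \<open>(dL\<^bsub>\<gamma>(t)\<^esub>)\<^sup>-\<^sup>1 \<gamma>'(t)\<close>; it is meaningful for almost every \<open>t\<close> when \<open>\<gamma>\<close> is
  absolutely continuous.\<close>

definition body_velocity :: "(real \<Rightarrow> heis) \<Rightarrow> real \<Rightarrow> heis" where
  "body_velocity \<gamma> t = inv (dL (\<gamma> t)) (vector_derivative \<gamma> (at t within {0..1}))"

definition curve_length :: "(heis \<Rightarrow> real) \<Rightarrow> (real \<Rightarrow> heis) \<Rightarrow> ennreal" where
  "curve_length N \<gamma> = (\<integral>\<^sup>+ t\<in>{0..1}. ennreal (N (body_velocity \<gamma> t)) \<partial>lebesgue)"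

definition curves_along :: "heis set \<Rightarrow> heis \<Rightarrow> heis \<Rightarrow> (real \<Rightarrow> heis) set" where
  "curves_along V p q =
     {\<gamma>. absolutely_continuous_curve \<gamma> \<and> \<gamma> 0 = p \<and> \<gamma> 1 = q \<and>
         (AE t in lebesgue. t \<in> {0..1} \<longrightarrow> body_velocity \<gamma> t \<in> V)}"

text \<open>The infimum is taken in \<^typ>\<open>ennreal\<close>; it is finite whenever \<open>V\<close> generates the Lie algebra,
  which is the case in both uses below (\<^term>\<open>UNIV\<close> and the first layer of a stratification).\<close>

definition length_distance :: "heis set \<Rightarrow> (heis \<Rightarrow> real) \<Rightarrow> heis \<Rightarrow> heis \<Rightarrow> real" where
  "length_distance V N p q = enn2real (INF \<gamma>\<in>curves_along V p q. curve_length N \<gamma>)"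

definition finsler_distance :: "(heis \<Rightarrow> real) \<Rightarrow> heis \<Rightarrow> heis \<Rightarrow> real" where
  "finsler_distance N = length_distance UNIV N"

text \<open>The layers are \<open>V 1, \<dots>, V s\<close>; the values of \<open>V\<close> at \<open>0\<close> and beyond \<open>s + 1\<close> are irrelevant.
  The bracket of two subspaces is the span of the brackets of their elements.\<close>

definition stratification :: "nat \<Rightarrow> (nat \<Rightarrow> heis set) \<Rightarrow> bool" where
  "stratification s V \<longleftrightarrow>
     1 \<le> s \<and>
     (\<forall>i\<in>{1..s}. subspace (V i)) \<and>
     (\<forall>x. \<exists>!f. f \<in> (\<Pi>\<^sub>E i\<in>{1..s}. V i) \<and> x = (\<Sum>i\<in>{1..s}. f i)) \<and>
     (\<forall>i\<in>{1..s}. span {lie_bracket v w |v w. v \<in> V 1 \<and> w \<in> V i} = V (Suc i)) \<and>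
     V (Suc s) = {0}"

definition norm_on :: "heis set \<Rightarrow> (heis \<Rightarrow> real) \<Rightarrow> bool" where
  "norm_on V N \<longleftrightarrow>
     (\<forall>v\<in>V. 0 \<le> N v) \<and>
     (\<forall>v\<in>V. N v = 0 \<longleftrightarrow> v = 0) \<and>
     (\<forall>v\<in>V. \<forall>c. N (c *\<^sub>R v) = \<bar>c\<bar> * N v) \<and>
     (\<forall>v\<in>V. \<forall>w\<in>V. N (v + w) \<le> N v + N w)"

definition carnot_metric :: "(heis \<Rightarrow> heis \<Rightarrow> real) \<Rightarrow> bool" where
  "carnot_metric d \<longleftrightarrow>
     (\<exists>s V N. stratification s V \<and> norm_on (V 1) N \<and> d = length_distance (V 1) N)"

text \<open>The inner product on \<open>span {X, Y}\<close> for which \<open>X, Y\<close> are orthonormal is the restriction of the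
  standard inner product of \<^typ>\<open>real ^ 3\<close>.\<close>

definition horizontal_part :: "heis \<Rightarrow> heis" where
  "horizontal_part v = v $ 1 *\<^sub>R X + v $ 2 *\<^sub>R Y"

definition max_norm :: "heis \<Rightarrow> real" where
  "max_norm v = max (sqrt (horizontal_part v \<bullet> horizontal_part v)) \<bar>v $ 3\<bar>"

lemma lie_bracket_basis:
  "lie_bracket X Y = Z" "lie_bracket X Z = 0" "lie_bracket Y Z = 0"
  by (simp_all add: lie_bracket_def X_def Y_def Z_def axis_def)

lemma dL_eq: "dL p v = v + (1 / 2) *\<^sub>R lie_bracket p v"
proof -
  have "(heis_mult p has_derivative (\<lambda>v. v + (1 / 2) *\<^sub>R lie_bracket p v)) (at 0)"
    unfolding heis_mult_def lie_bracket_def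
    by (rule has_derivative_eq_rhs, (rule derivative_intros bounded_linear.has_derivative
          [OF bounded_linear_vec_nth])+, simp)
  then have "(\<lambda>v. v + (1 / 2) *\<^sub>R lie_bracket p v) = dL p"
    unfolding dL_def by (rule frechet_derivative_at)
  then show ?thesis by metis
qed

lemma inv_dL_eq: "inv (dL p) w = w - (1 / 2) *\<^sub>R lie_bracket p w"
proof (rule inv_f_eq)
  have "u = dL p u - (1 / 2) *\<^sub>R lie_bracket p (dL p u)" for u
    by (simp add: dL_eq lie_bracket_def Z_def axis_def)
  then show "inj (dL p)" by (metis injI)
  show "dL p (w - (1 / 2) *\<^sub>R lie_bracket p w) = w"
    by (simp add: dL_eq lie_bracket_def Z_def axis_def)
qed

end

theory Submission
  imports Defs
begin

text \<open>
  The two distances are compared along the centre.  Let \<open>D z\<close> and \<open>F z\<close> be the distances from \<open>0\<close> to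
  \<open>z *\<^sub>R Z\<close> with respect to a Carnot metric and to the Finsler metric.

  A Carnot metric is homogeneous: its stratification carries dilations that double the lengths of
  curves and multiply the centre by 4, so \<open>D (4 * z) \<le> 2 * D z\<close> (\<open>carnot_scaling\<close>).  The Finsler
  distance violates this by a fixed amount, \<open>2 * F z + 1 / 8 \<le> F (4 * z)\<close> for \<open>z \<ge> 1\<close> (\<open>finsler_gap\<close>).
  Indeed, a curve may reach part of its height by moving in the direction of \<open>Z\<close>, and the maximum norm
  does not charge for this as long as the vertical speed stays below the horizontal one.  Halving a
  curve that leads to \<open>(4 * z) *\<^sub>R Z\<close> divides its vertical speed by 4 but its horizontal speed only
  by 2.  The vertical speed gained in this way pays for shrinking the curve a little further.  The
  gain does not fade out for large \<open>z\<close>: it is of the order of \<open>T\<^sup>2 / z\<close> for a curve of length \<open>T\<close>,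
  and \<open>T\<close> is at least of the order of \<open>sqrt z\<close>.

  If \<open>D - F\<close> tended to zero as \<open>D\<close> tends to infinity, these inequalities would contradict each other at
  points far out on the centre, where \<open>D\<close> is large by \<open>carnot_lower_bound\<close>.

  Every lower bound for a length rests on the fundamental theorem of calculus for absolutely
  continuous functions (\<open>abs_cont01_fundamental_theorem\<close>).  It is obtained by splitting a function into
  monotone parts with the help of its variation, taking the Radon-Nikodym densities of their Stieltjes
  measures, and applying Lebesgue's differentiation theorem.
\<close>

section \<open>Absolutely continuous functions on the unit interval\<close>

text \<open>
  The condition of \<^const>\<open>absolutely_continuous_curve\<close> for maps into an arbitrary metric space.  It is
  applied to curves, to their coordinates, to variation functions and to primitives.
\<close>

definition abs_cont01 :: "(real \<Rightarrow> 'a::metric_space) \<Rightarrow> bool" where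
  "abs_cont01 f \<longleftrightarrow>
     (\<forall>\<epsilon>>0. \<exists>\<delta>>0. \<forall>(n::nat) (a :: nat \<Rightarrow> real) (b :: nat \<Rightarrow> real).
        (\<forall>i<n. 0 \<le> a i \<and> a i \<le> b i \<and> b i \<le> 1) \<longrightarrow>
        disjoint_family_on (\<lambda>i. {a i<..<b i}) {..<n} \<longrightarrow>
        (\<Sum>i<n. b i - a i) < \<delta> \<longrightarrow>
        (\<Sum>i<n. dist (f (a i)) (f (b i))) < \<epsilon>)"

lemma absolutely_continuous_curve_iff: "absolutely_continuous_curve \<gamma> \<longleftrightarrow> abs_cont01 \<gamma>"
  by (simp add: absolutely_continuous_curve_def abs_cont01_def)

definition interval_family :: "real \<Rightarrow> real \<Rightarrow> 'i set \<Rightarrow> ('i \<Rightarrow> real) \<Rightarrow> ('i \<Rightarrow> real) \<Rightarrow> bool" where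
  "interval_family u v I a b \<longleftrightarrow> finite I \<and> (\<forall>i\<in>I. u \<le> a i \<and> a i \<le> b i \<and> b i \<le> v) \<and>
     disjoint_family_on (\<lambda>i. {a i<..<b i}) I"

text \<open>
  Any finite index type is admitted here.  Refining each interval of a family by a partition of its
  own produces a family that is naturally indexed by pairs.
\<close>

lemma abs_cont01D:
  fixes f :: "real \<Rightarrow> 'a::metric_space"
  assumes "abs_cont01 f" "\<epsilon> > 0"
  shows "\<exists>\<delta>>0. \<forall>(I :: 'i set) a b. interval_family 0 1 I a b \<longrightarrow> (\<Sum>i\<in>I. b i - a i) < \<delta> \<longrightarrow>
    (\<Sum>i\<in>I. dist (f (a i)) (f (b i))) < \<epsilon>"
proof -
  obtain \<delta> where "\<delta> > 0" and \<delta>: "\<And>(n::nat) (a :: nat \<Rightarrow> real) (b :: nat \<Rightarrow> real).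
        \<lbrakk>\<forall>i<n. 0 \<le> a i \<and> a i \<le> b i \<and> b i \<le> 1; disjoint_family_on (\<lambda>i. {a i<..<b i}) {..<n};
        (\<Sum>i<n. b i - a i) < \<delta>\<rbrakk> \<Longrightarrow> (\<Sum>i<n. dist (f (a i)) (f (b i))) < \<epsilon>"
    using assms unfolding abs_cont01_def by blast
  show ?thesis
  proof (intro exI[of _ \<delta>] conjI allI impI \<open>\<delta> > 0\<close>)
    fix I :: "'i set" and a b
    assume I: "interval_family 0 1 I a b" and less: "(\<Sum>i\<in>I. b i - a i) < \<delta>"
    obtain h where h: "bij_betw h {..<card I} I"
      using I ex_bij_betw_nat_finite by (metis atLeast0LessThan interval_family_def)
    have hI: "h i \<in> I" if "i < card I" for i
      using h that by (auto simp: bij_betw_def)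
    have "(\<Sum>i<card I. dist (f ((a \<circ> h) i)) (f ((b \<circ> h) i))) < \<epsilon>"
    proof (rule \<delta>)
      show "\<forall>i<card I. 0 \<le> (a \<circ> h) i \<and> (a \<circ> h) i \<le> (b \<circ> h) i \<and> (b \<circ> h) i \<le> 1"
        using I hI by (auto simp: interval_family_def)
      show "disjoint_family_on (\<lambda>i. {(a \<circ> h) i<..<(b \<circ> h) i}) {..<card I}"
        unfolding disjoint_family_on_def
      proof (intro ballI impI)
        fix m n assume "m \<in> {..<card I}" "n \<in> {..<card I}" "m \<noteq> n"
        then have "h m \<in> I" "h n \<in> I" "h m \<noteq> h n"
          using h by (auto simp: bij_betw_def inj_on_def)
        then show "{(a \<circ> h) m<..<(b \<circ> h) m} \<inter> {(a \<circ> h) n<..<(b \<circ> h) n} = {}"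
          using I by (auto simp: interval_family_def disjoint_family_on_def simp del: greaterThanLessThan_iff)
      qed
      show "(\<Sum>i<card I. (b \<circ> h) i - (a \<circ> h) i) < \<delta>"
        using less sum.reindex_bij_betw[OF h, of "\<lambda>i. b i - a i"] by simp
    qed
    then show "(\<Sum>i\<in>I. dist (f (a i)) (f (b i))) < \<epsilon>"
      using sum.reindex_bij_betw[OF h, of "\<lambda>i. dist (f (a i)) (f (b i))"] by simp
  qed
qed

lemma abs_cont01_I:
  assumes "\<And>\<epsilon>. \<epsilon> > 0 \<Longrightarrow> \<exists>\<delta>>0. \<forall>n a b. interval_family 0 1 {..<n::nat} a b \<longrightarrow>
     (\<Sum>i<n. b i - a i) < \<delta> \<longrightarrow> (\<Sum>i<n. dist (f (a i)) (f (b i))) < \<epsilon>"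
  shows "abs_cont01 f"
  using assms unfolding abs_cont01_def interval_family_def by (simp add: Ball_def imp_conjL)

lemma abs_cont01_comp_lipschitz:
  assumes f: "abs_cont01 f" and L: "\<And>x y. \<lbrakk>x \<in> f ` {0..1}; y \<in> f ` {0..1}\<rbrakk> \<Longrightarrow> dist (h x) (h y) \<le> L * dist x y"
  shows "abs_cont01 (\<lambda>t. h (f t))"
proof (rule abs_cont01_I)
  fix \<epsilon> :: real assume "\<epsilon> > 0"
  define K where "K = \<bar>L\<bar> + 1"
  have "K > 0" by (simp add: K_def)
  obtain \<delta> where "\<delta> > 0" and \<delta>: "\<And>(I :: nat set) a b. \<lbrakk>interval_family 0 1 I a b; (\<Sum>i\<in>I. b i - a i) < \<delta>\<rbrakk>
       \<Longrightarrow> (\<Sum>i\<in>I. dist (f (a i)) (f (b i))) < \<epsilon> / K"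
    using abs_cont01D[OF f divide_pos_pos[OF \<open>\<epsilon> > 0\<close> \<open>K > 0\<close>]] by blast
  have "(\<Sum>i<n. dist (h (f (a i))) (h (f (b i)))) < \<epsilon>"
    if ab: "interval_family 0 1 {..<n} a b" "(\<Sum>i<n. b i - a i) < \<delta>" for n :: nat and a b
  proof -
    have "(\<Sum>i<n. dist (h (f (a i))) (h (f (b i)))) \<le> (\<Sum>i<n. K * dist (f (a i)) (f (b i)))"
    proof (rule sum_mono)
      fix i assume "i \<in> {..<n}"
      then have "0 \<le> a i \<and> a i \<le> b i \<and> b i \<le> 1" using ab(1) unfolding interval_family_def by blast
      then have "a i \<in> {0..1}" "b i \<in> {0..1}" by auto
      then have "dist (h (f (a i))) (h (f (b i))) \<le> L * dist (f (a i)) (f (b i))" by (intro L) auto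
      also have "\<dots> \<le> K * dist (f (a i)) (f (b i))" by (intro mult_right_mono) (auto simp: K_def)
      finally show "dist (h (f (a i))) (h (f (b i))) \<le> K * dist (f (a i)) (f (b i))" .
    qed
    also have "\<dots> < \<epsilon>" using \<delta>[OF ab] \<open>K > 0\<close>
      by (simp add: sum_distrib_left[symmetric] field_simps)
    finally show ?thesis .
  qed
  then show "\<exists>\<delta>>0. \<forall>n a b. interval_family 0 1 {..<n::nat} a b \<longrightarrow>
     (\<Sum>i<n. b i - a i) < \<delta> \<longrightarrow> (\<Sum>i<n. dist (h (f (a i))) (h (f (b i)))) < \<epsilon>"
    using \<open>\<delta> > 0\<close> by blast
qed

lemma abs_cont01_ident: "abs_cont01 (\<lambda>t::real. t)"
proof (rule abs_cont01_I)
  fix \<epsilon> :: real assume "\<epsilon> > 0"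
  have "(\<Sum>i<n. dist (a i) (b i)) = (\<Sum>i<n. b i - a i)"
    if "interval_family 0 1 {..<n} a b" for n :: nat and a b
    using that by (intro sum.cong) (auto simp: interval_family_def dist_real_def)
  then show "\<exists>\<delta>>0. \<forall>n a b. interval_family 0 1 {..<n::nat} a b \<longrightarrow>
     (\<Sum>i<n. b i - a i) < \<delta> \<longrightarrow> (\<Sum>i<n. dist (a i) (b i)) < \<epsilon>"
    using \<open>\<epsilon> > 0\<close> by auto
qed

lemma abs_cont01_dominated:
  assumes f: "abs_cont01 f" and g: "abs_cont01 g"
    and le: "\<And>x y. \<lbrakk>0 \<le> x; x \<le> y; y \<le> 1\<rbrakk> \<Longrightarrow> dist (h x) (h y) \<le> dist (f x) (f y) + dist (g x) (g y)"
  shows "abs_cont01 h"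
proof (rule abs_cont01_I)
  fix \<epsilon> :: real assume "\<epsilon> > 0"
  obtain \<delta>1 where "\<delta>1 > 0" and \<delta>1: "\<And>(I :: nat set) a b. \<lbrakk>interval_family 0 1 I a b; (\<Sum>i\<in>I. b i - a i) < \<delta>1\<rbrakk>
       \<Longrightarrow> (\<Sum>i\<in>I. dist (f (a i)) (f (b i))) < \<epsilon> / 2"
    using abs_cont01D[OF f half_gt_zero[OF \<open>\<epsilon> > 0\<close>]] by blast
  obtain \<delta>2 where "\<delta>2 > 0" and \<delta>2: "\<And>(I :: nat set) a b. \<lbrakk>interval_family 0 1 I a b; (\<Sum>i\<in>I. b i - a i) < \<delta>2\<rbrakk>
       \<Longrightarrow> (\<Sum>i\<in>I. dist (g (a i)) (g (b i))) < \<epsilon> / 2"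
    using abs_cont01D[OF g half_gt_zero[OF \<open>\<epsilon> > 0\<close>]] by blast
  have "(\<Sum>i<n. dist (h (a i)) (h (b i))) < \<epsilon>"
    if ab: "interval_family 0 1 {..<n} a b" "(\<Sum>i<n. b i - a i) < min \<delta>1 \<delta>2" for n :: nat and a b
  proof -
    have "(\<Sum>i<n. dist (h (a i)) (h (b i))) \<le> (\<Sum>i<n. dist (f (a i)) (f (b i)) + dist (g (a i)) (g (b i)))"
      using ab(1) by (intro sum_mono le) (auto simp: interval_family_def)
    also have "\<dots> < \<epsilon>" using \<delta>1[OF ab(1)] \<delta>2[OF ab(1)] ab(2) by (simp add: sum.distrib)
    finally show ?thesis .
  qed
  then show "\<exists>\<delta>>0. \<forall>n a b. interval_family 0 1 {..<n::nat} a b \<longrightarrow>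
     (\<Sum>i<n. b i - a i) < \<delta> \<longrightarrow> (\<Sum>i<n. dist (h (a i)) (h (b i))) < \<epsilon>"
    using \<open>\<delta>1 > 0\<close> \<open>\<delta>2 > 0\<close> by (intro exI[of _ "min \<delta>1 \<delta>2"]) auto
qed

lemma abs_cont01_add:
  fixes f g :: "real \<Rightarrow> 'a::real_normed_vector"
  assumes "abs_cont01 f" "abs_cont01 g"
  shows "abs_cont01 (\<lambda>t. f t + g t)"
  by (rule abs_cont01_dominated[OF assms]) (rule dist_triangle_add)

lemma abs_cont01_linear:
  fixes f :: "real \<Rightarrow> 'a::real_normed_vector"
  assumes "abs_cont01 f" "bounded_linear h"
  shows "abs_cont01 (\<lambda>t. h (f t))"
proof -
  obtain K where K: "\<And>x. norm (h x) \<le> norm x * K" using assms(2) bounded_linear.bounded by blast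
  show ?thesis
    by (rule abs_cont01_comp_lipschitz[OF assms(1), where L = K])
      (metis K assms(2) bounded_linear.linear dist_norm linear_diff mult.commute)
qed

lemma abs_cont01_continuous:
  assumes "abs_cont01 f"
  shows "continuous_on {0..1} f"
proof -
  have "\<exists>d>0. \<forall>y\<in>{0..1}. dist y x < d \<longrightarrow> dist (f y) (f x) < \<epsilon>" if x: "x \<in> {0..1}" and "\<epsilon> > 0" for x \<epsilon>
  proof -
    obtain \<delta> where "\<delta> > 0" and \<delta>: "\<And>(I :: nat set) a b. \<lbrakk>interval_family 0 1 I a b; (\<Sum>i\<in>I. b i - a i) < \<delta>\<rbrakk>
       \<Longrightarrow> (\<Sum>i\<in>I. dist (f (a i)) (f (b i))) < \<epsilon>"
      using abs_cont01D[OF assms \<open>\<epsilon> > 0\<close>] by blast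
    have "dist (f y) (f x) < \<epsilon>" if "y \<in> {0..1}" "dist y x < \<delta>" for y
    proof (cases "x \<le> y")
      case True
      with x that show ?thesis using \<delta>[of "{0}" "\<lambda>_. x" "\<lambda>_. y"]
        by (auto simp: interval_family_def disjoint_family_on_def dist_real_def dist_commute)
    next
      case False
      with x that show ?thesis using \<delta>[of "{0}" "\<lambda>_. y" "\<lambda>_. x"]
        by (auto simp: interval_family_def disjoint_family_on_def dist_real_def)
    qed
    then show ?thesis using \<open>\<delta> > 0\<close> by blast
  qed
  then show ?thesis unfolding continuous_on_iff by blast
qed

section \<open>Total variation\<close>

text \<open>
  The value \<open>s\<close> is the sum of the distances between the images of consecutive points of some partition
  of \<open>[a, c]\<close>.  Generating partitions from the left turns concatenation and splitting into inductions
  over the derivation.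
\<close>

inductive variation_sum :: "(real \<Rightarrow> 'a::metric_space) \<Rightarrow> real \<Rightarrow> real \<Rightarrow> real \<Rightarrow> bool" for f where
  nil: "variation_sum f a a 0"
| step: "a \<le> b \<Longrightarrow> variation_sum f b c s \<Longrightarrow> variation_sum f a c (dist (f a) (f b) + s)"

lemma variation_sum_le: "variation_sum f a c s \<Longrightarrow> a \<le> c"
  by (induction rule: variation_sum.induct) auto

lemma variation_sum_degenerate: "variation_sum f a a s \<Longrightarrow> s \<le> 0"
proof (induction a a\<equiv>a s rule: variation_sum.induct)
  case (step a b s)
  then show ?case using variation_sum_le by fastforce
qed simp

lemma variation_sum_concat:
  "variation_sum f a b s \<Longrightarrow> variation_sum f b c t \<Longrightarrow> variation_sum f a c (s + t)"
  by (induction rule: variation_sum.induct) (auto simp: add.assoc intro: variation_sum.intros)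

lemma variation_sum_single: "a \<le> b \<Longrightarrow> variation_sum f a b (dist (f a) (f b))"
  using variation_sum.step[OF _ variation_sum.nil, of a b f] by simp

text \<open>
  Inserting the point \<open>b\<close> into a partition does not decrease its sum, by the triangle inequality.
\<close>

lemma variation_sum_split:
  assumes "variation_sum f a c s" "a \<le> b" "b \<le> c"
  shows "\<exists>s1 s2. variation_sum f a b s1 \<and> variation_sum f b c s2 \<and> s \<le> s1 + s2"
  using assms
proof (induction rule: variation_sum.induct)
  case (nil a)
  then show ?case by (metis add.right_neutral order.refl order.antisym variation_sum.nil)
next
  case (step a m c s)
  show ?case
  proof (cases "m \<le> b")
    case True
    then obtain s1 s2 where s: "variation_sum f m b s1" "variation_sum f b c s2" "s \<le> s1 + s2"
      using step by blast
    have "variation_sum f a b (dist (f a) (f m) + s1)"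
      using s(1) step.hyps(1) by (rule variation_sum.step[rotated])
    with s show ?thesis by (intro exI[of _ "dist (f a) (f m) + s1"] exI[of _ s2]) auto
  next
    case False
    have "variation_sum f b c (dist (f b) (f m) + s)"
      using step.hyps(2) False by (intro variation_sum.step) auto
    moreover have "variation_sum f a b (dist (f a) (f b))"
      using step.prems by (intro variation_sum_single)
    ultimately show ?thesis
      using dist_triangle[of "f a" "f m" "f b"]
      by (intro exI[of _ "dist (f a) (f b)"] exI[of _ "dist (f b) (f m) + s"]) auto
  qed
qed

lemma variation_sum_interval_family:
  assumes "variation_sum f a c s"
  shows "\<exists>n A B. interval_family a c {..<n::nat} A B \<and> (\<Sum>i<n. B i - A i) = c - a \<and>
    (\<Sum>i<n. dist (f (A i)) (f (B i))) = s"
  using assms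
proof (induction rule: variation_sum.induct)
  case (nil a)
  then show ?case by (intro exI[of _ 0]) (auto simp: interval_family_def disjoint_family_on_def)
next
  case (step a b c s)
  then obtain n A B where AB: "interval_family b c {..<n::nat} A B" "(\<Sum>i<n. B i - A i) = c - b"
    "(\<Sum>i<n. dist (f (A i)) (f (B i))) = s" by blast
  define A' where "A' = case_nat a A"
  define B' where "B' = case_nat b B"
  have "b \<le> c" using step variation_sum_le by blast
  have "interval_family a c {..<Suc n} A' B'"
    unfolding interval_family_def
  proof (intro conjI ballI)
    fix i assume "i \<in> {..<Suc n}"
    then show "a \<le> A' i" "A' i \<le> B' i" "B' i \<le> c"
      using AB(1) step.hyps \<open>b \<le> c\<close>
      by (cases i; force simp: A'_def B'_def interval_family_def)+
  next
    have 1: "{A i<..<B i} \<inter> {A j<..<B j} = {}" if "i < n" "j < n" "i \<noteq> j" for i j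
      using AB(1) that unfolding interval_family_def disjoint_family_on_def by auto
    have 2: "{a<..<b} \<inter> {A j<..<B j} = {}" if "j < n" for j
      using AB(1) that unfolding interval_family_def by force
    show "disjoint_family_on (\<lambda>i. {A' i<..<B' i}) {..<Suc n}"
      unfolding disjoint_family_on_def
    proof (intro ballI impI)
      fix i j assume ij: "i \<in> {..<Suc n}" "j \<in> {..<Suc n}" "i \<noteq> j"
      show "{A' i<..<B' i} \<inter> {A' j<..<B' j} = {}"
      proof (cases i)
        case 0
        then obtain j' where "j = Suc j'" using ij by (cases j) auto
        with 0 ij 2[of j'] show ?thesis by (auto simp: A'_def B'_def simp del: greaterThanLessThan_iff)
      next
        case (Suc i')
        show ?thesis
        proof (cases j)
          case 0
          with Suc ij 2[of i'] show ?thesis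
            by (auto simp: A'_def B'_def simp del: greaterThanLessThan_iff)
        next
          case (Suc j')
          with \<open>i = Suc i'\<close> ij 1[of i' j'] show ?thesis
            by (auto simp: A'_def B'_def simp del: greaterThanLessThan_iff)
        qed
      qed
    qed
  qed auto
  moreover have "(\<Sum>i<Suc n. B' i - A' i) = c - a"
    using AB(2) by (subst sum.lessThan_Suc_shift) (simp add: A'_def B'_def)
  moreover have "(\<Sum>i<Suc n. dist (f (A' i)) (f (B' i))) = dist (f a) (f b) + s"
    using AB(3) by (subst sum.lessThan_Suc_shift) (simp add: A'_def B'_def)
  ultimately show ?case by blast
qed

lemma interval_family_mono: "interval_family u v I a b \<Longrightarrow> u' \<le> u \<Longrightarrow> v \<le> v' \<Longrightarrow> interval_family u' v' I a b"
  by (force simp: interval_family_def)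

text \<open>
  Take \<open>\<delta>\<close> for \<open>\<epsilon> = 1\<close>: sums over intervals shorter than \<open>\<delta>\<close> stay below 1, and finitely many such
  intervals cover the unit interval.
\<close>

lemma variation_sum_bounded:
  assumes "abs_cont01 f"
  shows "\<exists>K. \<forall>x\<in>{0..1}. \<forall>s. variation_sum f 0 x s \<longrightarrow> s \<le> K"
proof -
  obtain \<delta> where "\<delta> > 0" and \<delta>: "\<And>(I :: nat set) a b. \<lbrakk>interval_family 0 1 I a b; (\<Sum>i\<in>I. b i - a i) < \<delta>\<rbrakk>
       \<Longrightarrow> (\<Sum>i\<in>I. dist (f (a i)) (f (b i))) < 1"
    using abs_cont01D[OF assms zero_less_one] by blast
  have short: "s < 1" if *: "variation_sum f a c s" "0 \<le> a" "c \<le> 1" "c - a < \<delta>" for a c s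
  proof -
    obtain n A B where AB: "interval_family a c {..<n::nat} A B" "(\<Sum>i<n. B i - A i) = c - a"
      "(\<Sum>i<n. dist (f (A i)) (f (B i))) = s"
      using variation_sum_interval_family[OF *(1)] by blast
    then show ?thesis using \<delta>[OF interval_family_mono[OF AB(1) *(2,3)]] *(4) by simp
  qed
  have "s \<le> real n" if "variation_sum f a c s" "0 \<le> a" "c \<le> 1" "c - a < n * (\<delta> / 2)" for n a c s
    using that
  proof (induction n arbitrary: a s)
    case 0
    then show ?case using variation_sum_le[OF 0(1)] by auto
  next
    case (Suc n)
    define b where "b = min c (a + \<delta> / 2)"
    have b: "a \<le> b" "b \<le> c" "b - a < \<delta>"
      using variation_sum_le[OF Suc.prems(1)] \<open>\<delta> > 0\<close> by (auto simp: b_def)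
    obtain s1 s2 where s: "variation_sum f a b s1" "variation_sum f b c s2" "s \<le> s1 + s2"
      using variation_sum_split[OF Suc.prems(1) b(1,2)] by blast
    have "s1 < 1" using short[OF s(1)] b Suc.prems by auto
    moreover have "s2 \<le> real n"
    proof (cases "b = c")
      case True
      have "s2 \<le> 0" using s(2) unfolding True
        by (rule variation_sum_degenerate)
      then show ?thesis by simp
    next
      case False
      then have "b = a + \<delta> / 2" by (auto simp: b_def min_def split: if_splits)
      then show ?thesis using Suc.IH[OF s(2)] b Suc.prems by (auto simp: algebra_simps)
    qed
    ultimately show ?case using s(3) by auto
  qed
  moreover obtain n :: nat where "1 < n * (\<delta> / 2)"
    using \<open>\<delta> > 0\<close> by (metis half_gt_zero reals_Archimedean3)
  ultimately show ?thesis by (intro exI[of _ "real n"]) fastforce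
qed

definition variation_fun :: "(real \<Rightarrow> 'a::metric_space) \<Rightarrow> real \<Rightarrow> real" where
  "variation_fun f x = Sup {s. variation_sum f 0 x s}"

lemma variation_sum_le_variation_fun:
  assumes "abs_cont01 f" "x \<in> {0..1}" "variation_sum f 0 x s"
  shows "s \<le> variation_fun f x"
proof -
  have "bdd_above {s. variation_sum f 0 x s}"
    using variation_sum_bounded[OF assms(1)] assms(2) unfolding bdd_above_def by blast
  then show ?thesis unfolding variation_fun_def using assms(3) by (intro cSup_upper) auto
qed

lemma variation_fun_approx:
  assumes "0 \<le> x" "\<eta> > 0"
  obtains s where "variation_sum f 0 x s" "variation_fun f x < s + \<eta>"
proof -
  have "{s. variation_sum f 0 x s} \<noteq> {}" using variation_sum_single[OF assms(1)] by blast
  then obtain s where "variation_sum f 0 x s" "variation_fun f x - \<eta> < s"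
    using less_cSupD[of "{s. variation_sum f 0 x s}" "variation_fun f x - \<eta>"] assms(2)
    by (auto simp: variation_fun_def)
  then show ?thesis using that by auto
qed

lemma dist_le_variation_fun:
  assumes "abs_cont01 f" "0 \<le> x" "x \<le> y" "y \<le> 1"
  shows "variation_fun f x + dist (f x) (f y) \<le> variation_fun f y"
proof (rule field_le_epsilon)
  fix \<eta> :: real assume "\<eta> > 0"
  obtain s where s: "variation_sum f 0 x s" "variation_fun f x < s + \<eta>"
    using variation_fun_approx[OF \<open>0 \<le> x\<close> \<open>\<eta> > 0\<close>] .
  have "variation_sum f 0 y (s + dist (f x) (f y))"
    by (intro variation_sum_concat[OF s(1)] variation_sum_single assms)
  then have "s + dist (f x) (f y) \<le> variation_fun f y"
    using assms by (intro variation_sum_le_variation_fun) auto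
  with s(2) show "variation_fun f x + dist (f x) (f y) \<le> variation_fun f y + \<eta>" by simp
qed

lemma variation_fun_increment_approx:
  assumes "abs_cont01 f" "0 \<le> x" "x \<le> y" "y \<le> 1" "\<eta> > 0"
  shows "\<exists>s. variation_sum f x y s \<and> variation_fun f y - variation_fun f x < s + \<eta>"
proof -
  obtain s where s: "variation_sum f 0 y s" "variation_fun f y < s + \<eta>"
    using variation_fun_approx[of y \<eta> f] assms by auto
  obtain s1 s2 where "variation_sum f 0 x s1" "variation_sum f x y s2" "s \<le> s1 + s2"
    using variation_sum_split[OF s(1) \<open>0 \<le> x\<close> \<open>x \<le> y\<close>] by blast
  moreover have "s1 \<le> variation_fun f x"
    using assms calculation by (intro variation_sum_le_variation_fun) auto
  ultimately show ?thesis using s(2) by (intro exI[of _ s2]) auto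
qed

text \<open>
  The increment of the variation over an interval is attained, up to \<open>\<eta>\<close>, by a partition of that
  interval.  The partitions of all intervals of a family form together a single family of the same
  total length, to which the absolute continuity of \<open>f\<close> applies.
\<close>

lemma abs_cont01_variation_fun:
  assumes "abs_cont01 f"
  shows "abs_cont01 (variation_fun f)"
proof (rule abs_cont01_I)
  fix \<epsilon> :: real assume "\<epsilon> > 0"
  obtain \<delta> where "\<delta> > 0" and \<delta>: "\<And>(I :: (nat \<times> nat) set) a b. \<lbrakk>interval_family 0 1 I a b; (\<Sum>i\<in>I. b i - a i) < \<delta>\<rbrakk>
       \<Longrightarrow> (\<Sum>i\<in>I. dist (f (a i)) (f (b i))) < \<epsilon> / 2"
    using abs_cont01D[OF assms half_gt_zero[OF \<open>\<epsilon> > 0\<close>]] by blast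
  have "(\<Sum>i<n. dist (variation_fun f (a i)) (variation_fun f (b i))) < \<epsilon>"
    if ab: "interval_family 0 1 {..<n} a b" "(\<Sum>i<n. b i - a i) < \<delta>" for n :: nat and a b
  proof -
    \<comment> \<open>The \<open>n\<close> errors add up to less than \<open>\<epsilon> / 2\<close>.\<close>
    define \<eta> where "\<eta> = \<epsilon> / (2 * (n + 1))"
    have "\<eta> > 0" using \<open>\<epsilon> > 0\<close> by (simp add: \<eta>_def)
    have ab': "0 \<le> a i" "a i \<le> b i" "b i \<le> 1" if "i < n" for i
      using ab(1) that by (auto simp: interval_family_def)
    have "\<exists>m A B. interval_family (a i) (b i) {..<m::nat} A B \<and> (\<Sum>j<m. B j - A j) = b i - a i \<and>
      dist (variation_fun f (a i)) (variation_fun f (b i)) \<le> (\<Sum>j<m. dist (f (A j)) (f (B j))) + \<eta>"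
      if i: "i < n" for i
    proof -
      obtain s where s: "variation_sum f (a i) (b i) s" 
        "variation_fun f (b i) - variation_fun f (a i) < s + \<eta>"
        using variation_fun_increment_approx[OF assms ab'[OF i] \<open>\<eta> > 0\<close>] by blast
      moreover have "variation_fun f (a i) \<le> variation_fun f (b i)"
        using dist_le_variation_fun[OF assms ab'[OF i]] zero_le_dist[of "f (a i)" "f (b i)"] by linarith
      ultimately have "dist (variation_fun f (a i)) (variation_fun f (b i)) \<le> s + \<eta>"
        by (simp add: dist_real_def)
      moreover obtain m A B where "interval_family (a i) (b i) {..<m::nat} A B"
        "(\<Sum>j<m. B j - A j) = b i - a i" "(\<Sum>j<m. dist (f (A j)) (f (B j))) = s"
        using variation_sum_interval_family[OF s(1)] by blast
      ultimately show ?thesis by blast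
    qed
    then have "\<forall>i. \<exists>m A B. i < n \<longrightarrow> interval_family (a i) (b i) {..<m::nat} A B \<and> (\<Sum>j<m. B j - A j) = b i - a i \<and>
      dist (variation_fun f (a i)) (variation_fun f (b i)) \<le> (\<Sum>j<m. dist (f (A j)) (f (B j))) + \<eta>"
      by blast
    then obtain m A B where "\<forall>i. i < n \<longrightarrow> interval_family (a i) (b i) {..<m i::nat} (A i) (B i) \<and>
      (\<Sum>j<m i. B i j - A i j) = b i - a i \<and>
      dist (variation_fun f (a i)) (variation_fun f (b i)) \<le> (\<Sum>j<m i. dist (f (A i j)) (f (B i j))) + \<eta>"
      unfolding choice_iff by blast
    then have mAB: "\<And>i. i < n \<Longrightarrow> interval_family (a i) (b i) {..<m i::nat} (A i) (B i)"
      "\<And>i. i < n \<Longrightarrow> (\<Sum>j<m i. B i j - A i j) = b i - a i"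
      "\<And>i. i < n \<Longrightarrow> dist (variation_fun f (a i)) (variation_fun f (b i)) \<le> (\<Sum>j<m i. dist (f (A i j)) (f (B i j))) + \<eta>"
      by blast+
    define I where "I = (SIGMA i:{..<n}. {..<m i})"
    have AB: "a i \<le> A i j \<and> A i j \<le> B i j \<and> B i j \<le> b i" if "i < n" "j < m i" for i j
      using mAB(1)[OF that(1)] that by (auto simp: interval_family_def)
    have fam: "interval_family 0 1 I (\<lambda>(i, j). A i j) (\<lambda>(i, j). B i j)"
      unfolding interval_family_def
    proof (intro conjI ballI)
      show "disjoint_family_on (\<lambda>p. {(case p of (i, j) \<Rightarrow> A i j)<..<(case p of (i, j) \<Rightarrow> B i j)}) I"
        unfolding disjoint_family_on_def
      proof (intro ballI impI)
        fix p q assume pq: "p \<in> I" "q \<in> I" "p \<noteq> q"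
        obtain i j i' j' where [simp]: "p = (i, j)" "q = (i', j')" by (cases p, cases q)
        have ij: "i < n" "j < m i" "i' < n" "j' < m i'" using pq by (auto simp: I_def)
        show "{(case p of (i, j) \<Rightarrow> A i j)<..<(case p of (i, j) \<Rightarrow> B i j)} \<inter>
              {(case q of (i, j) \<Rightarrow> A i j)<..<(case q of (i, j) \<Rightarrow> B i j)} = {}"
        proof (cases "i = i'")
          case True
          then show ?thesis using mAB(1)[OF ij(1)] ij pq
            unfolding interval_family_def disjoint_family_on_def by auto
        next
          case False
          then have "{a i<..<b i} \<inter> {a i'<..<b i'} = {}"
            using ab(1) ij unfolding interval_family_def disjoint_family_on_def by auto
          moreover have "{A i j<..<B i j} \<subseteq> {a i<..<b i}" "{A i' j'<..<B i' j'} \<subseteq> {a i'<..<b i'}"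
            using AB ij by fastforce+
          ultimately show ?thesis by (simp del: Int_greaterThanLessThan) blast
        qed
      qed
    qed (use AB ab' in \<open>force simp: I_def\<close>)+
    have "(\<Sum>p\<in>I. (case p of (i, j) \<Rightarrow> B i j) - (case p of (i, j) \<Rightarrow> A i j)) = (\<Sum>i<n. \<Sum>j<m i. B i j - A i j)"
      unfolding I_def by (subst sum.Sigma) (auto intro: sum.cong)
    also have "\<dots> < \<delta>" using ab(2) mAB(2) by simp
    finally have "(\<Sum>p\<in>I. dist (f (case p of (i, j) \<Rightarrow> A i j)) (f (case p of (i, j) \<Rightarrow> B i j))) < \<epsilon> / 2"
      using \<delta>[OF fam] by simp
    also have "(\<Sum>p\<in>I. dist (f (case p of (i, j) \<Rightarrow> A i j)) (f (case p of (i, j) \<Rightarrow> B i j))) =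
       (\<Sum>i<n. \<Sum>j<m i. dist (f (A i j)) (f (B i j)))"
      unfolding I_def by (subst sum.Sigma) (auto intro: sum.cong)
    finally have 1: "(\<Sum>i<n. \<Sum>j<m i. dist (f (A i j)) (f (B i j))) < \<epsilon> / 2" .
    have "(\<Sum>i<n. dist (variation_fun f (a i)) (variation_fun f (b i))) \<le>
      (\<Sum>i<n. (\<Sum>j<m i. dist (f (A i j)) (f (B i j))) + \<eta>)"
      using mAB(3) by (intro sum_mono) auto
    also have "\<dots> = (\<Sum>i<n. \<Sum>j<m i. dist (f (A i j)) (f (B i j))) + n * \<eta>"
      by (simp add: sum.distrib)
    also have "n * \<eta> < \<epsilon> / 2" using \<open>\<epsilon> > 0\<close> by (simp add: \<eta>_def field_simps)
    finally show ?thesis using 1 by simp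
  qed
  then show "\<exists>\<delta>>0. \<forall>n a b. interval_family 0 1 {..<n::nat} a b \<longrightarrow>
     (\<Sum>i<n. b i - a i) < \<delta> \<longrightarrow> (\<Sum>i<n. dist (variation_fun f (a i)) (variation_fun f (b i))) < \<epsilon>"
    using \<open>\<delta> > 0\<close> by blast
qed

section \<open>The fundamental theorem of calculus for absolutely continuous functions\<close>

text \<open>
  A null set is covered by nonoverlapping intervals whose lengths add up to less than \<open>\<delta>\<close>.  Finitely
  many of these have Stieltjes mass at most \<open>\<epsilon>\<close>, because their masses are the increments of \<open>F\<close>;
  hence so has the countable union.
\<close>

lemma absolutely_continuous_stieltjes_measure:
  fixes F :: "real \<Rightarrow> real"
  assumes F: "abs_cont01 F" and mono: "\<And>x y. \<lbrakk>0 \<le> x; x \<le> y; y \<le> 1\<rbrakk> \<Longrightarrow> F x \<le> F y"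
  assumes G: "\<And>x y. x \<le> y \<Longrightarrow> G x \<le> G y" "continuous_on UNIV G" "\<And>x. x \<in> {0..1} \<Longrightarrow> G x = F x"
  assumes A: "A \<in> sets borel" "emeasure lborel A = 0" "A \<subseteq> {0..1}"
  shows "emeasure (interval_measure G) A = 0"
proof -
  let ?\<mu> = "interval_measure G"
  have "emeasure ?\<mu> A \<le> ennreal \<epsilon>" if "\<epsilon> > 0" for \<epsilon>
  proof -
    obtain \<delta> where "\<delta> > 0" and \<delta>: "\<And>(I :: real set set) a b. \<lbrakk>interval_family 0 1 I a b; (\<Sum>i\<in>I. b i - a i) < \<delta>\<rbrakk>
       \<Longrightarrow> (\<Sum>i\<in>I. dist (F (a i)) (F (b i))) < \<epsilon>"
      using abs_cont01D[OF F \<open>\<epsilon> > 0\<close>] by blast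
    have A0: "A \<in> lmeasurable" "measure lebesgue A = 0"
      using A by (auto simp: fmeasurable_def measure_def)
    have "A \<subseteq> cbox 0 1" using A(3) by (simp add: cbox_interval)
    have "\<exists>\<D>. countable \<D> \<and> (\<forall>K\<in>\<D>. K \<subseteq> {0..1} \<and> K \<noteq> {} \<and> (\<exists>c d. K = {c..d::real})) \<and>
      pairwise (\<lambda>A B. interior A \<inter> interior B = {}) \<D> \<and> A \<subseteq> \<Union>\<D> \<and>
      \<Union>\<D> \<in> lmeasurable \<and> measure lebesgue (\<Union>\<D>) \<le> \<delta> / 2"
    proof (rule measurable_outer_intervals_bounded[OF A0(1) \<open>A \<subseteq> cbox 0 1\<close> half_gt_zero[OF \<open>\<delta> > 0\<close>]])
      fix \<D>
      assume *: "countable \<D>" "\<And>K. K \<in> \<D> \<Longrightarrow> K \<subseteq> cbox 0 1 \<and> K \<noteq> {} \<and> (\<exists>c d. K = cbox c d)"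
        "pairwise (\<lambda>A B. interior A \<inter> interior B = {}) \<D>" "A \<subseteq> \<Union>\<D>"
        "\<Union>\<D> \<in> lmeasurable" "measure lebesgue (\<Union>\<D>) \<le> measure lebesgue A + \<delta> / 2"
      show ?thesis
        using * A0(2) by (intro exI[of _ \<D>] conjI ballI) simp_all
    qed
    then obtain \<D> where \<D>: "countable \<D>" "\<forall>K\<in>\<D>. K \<subseteq> {0..1} \<and> K \<noteq> {} \<and> (\<exists>c d. K = {c..d::real})"
      "pairwise (\<lambda>A B. interior A \<inter> interior B = {}) \<D>" "A \<subseteq> \<Union>\<D>"
      "\<Union>\<D> \<in> lmeasurable" "measure lebesgue (\<Union>\<D>) \<le> \<delta> / 2"
      by (elim exE conjE)
    have K: "K = {Inf K..Sup K} \<and> 0 \<le> Inf K \<and> Inf K \<le> Sup K \<and> Sup K \<le> 1" if "K \<in> \<D>" for K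
      using \<D>(2) that by fastforce
    have fin: "emeasure ?\<mu> (\<Union>\<E>) \<le> ennreal \<epsilon>" if \<E>: "finite \<E>" "\<E> \<subseteq> \<D>" for \<E>
    proof -
      have disj: "disjoint_family_on (\<lambda>K. {Inf K<..<Sup K}) \<E>"
        unfolding disjoint_family_on_def
      proof (intro ballI impI)
        fix K L assume KL: "K \<in> \<E>" "L \<in> \<E>" "K \<noteq> L"
        have "interior K = {Inf K<..<Sup K}" "interior L = {Inf L<..<Sup L}"
          using K KL \<E>(2) interior_atLeastAtMost_real by (metis subsetD)+
        then show "{Inf K<..<Sup K} \<inter> {Inf L<..<Sup L} = {}"
          using \<D>(3) KL \<E>(2) unfolding pairwise_def by (metis subsetD)
      qed
      have fam: "interval_family 0 1 \<E> Inf Sup"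
        unfolding interval_family_def using disj K \<E> by blast
      have le: "Inf K \<le> Sup K" if "K \<in> \<E>" for K using K \<E>(2) that by blast
      have "(\<Sum>K\<in>\<E>. Sup K - Inf K) = (\<Sum>K\<in>\<E>. measure lebesgue {Inf K<..<Sup K})"
        using K \<E>(2) by (intro sum.cong) auto
      also have "\<dots> = measure lebesgue (\<Union>K\<in>\<E>. {Inf K<..<Sup K})"
        by (rule measure_finite_Union[symmetric]) (use \<E> disj le in auto)
      also have "\<dots> \<le> measure lebesgue (\<Union>\<D>)"
      proof (rule measure_mono_fmeasurable)
        have "{Inf K<..<Sup K} \<subseteq> K" if "K \<in> \<D>" for K
          using K[OF that] greaterThanLessThan_subseteq_atLeastAtMost_iff by blast
        then show "(\<Union>K\<in>\<E>. {Inf K<..<Sup K}) \<subseteq> \<Union>\<D>" using \<E>(2) by blast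
      qed (use \<D>(5) \<E> in auto)
      finally have "(\<Sum>K\<in>\<E>. Sup K - Inf K) < \<delta>" using \<D>(6) \<open>\<delta> > 0\<close> by linarith
      then have less: "(\<Sum>K\<in>\<E>. dist (F (Inf K)) (F (Sup K))) < \<epsilon>" by (rule \<delta>[OF fam])
      have "emeasure ?\<mu> (\<Union>K\<in>\<E>. K) \<le> (\<Sum>K\<in>\<E>. emeasure ?\<mu> K)"
        using K \<E> by (intro emeasure_subadditive_finite) (auto, metis atLeastAtMost_borel subsetD)
      also have "\<dots> = (\<Sum>K\<in>\<E>. ennreal (dist (F (Inf K)) (F (Sup K))))"
      proof (rule sum.cong)
        fix K assume "K \<in> \<E>"
        then have *: "K = {Inf K..Sup K}" "0 \<le> Inf K" "Inf K \<le> Sup K" "Sup K \<le> 1"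
          using K \<E>(2) by auto
        have "emeasure ?\<mu> K = emeasure ?\<mu> {Inf K..Sup K}" using *(1) by simp
        also have "\<dots> = ennreal (G (Sup K) - G (Inf K))"
          using *(3) G(1,2) by (rule emeasure_interval_measure_Icc)
        also have "\<dots> = ennreal (dist (F (Inf K)) (F (Sup K)))"
          using * mono[OF *(2-4)] G(3)[of "Inf K"] G(3)[of "Sup K"] by (simp add: dist_real_def)
        finally show "emeasure ?\<mu> K = ennreal (dist (F (Inf K)) (F (Sup K)))" .
      qed simp
      also have "\<dots> = ennreal (\<Sum>K\<in>\<E>. dist (F (Inf K)) (F (Sup K)))" by simp
      also have "\<dots> \<le> ennreal \<epsilon>" using less by (intro ennreal_leI) simp
      finally show ?thesis by simp
    qed
    show ?thesis
    proof (cases "\<D> = {}")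
      case True
      with \<D>(4) show ?thesis by simp
    next
      case False
      \<comment> \<open>The finite unions exhaust the cover, so their bound passes to its measure.\<close>
      define U where "U n = \<Union>(from_nat_into \<D> ` {..<n})" for n
      have sub: "from_nat_into \<D> ` {..<n} \<subseteq> \<D>" for n
        using from_nat_into[OF False] by auto
      have "\<Union>\<D> = (\<Union>n. U n)"
        using range_from_nat_into[OF False \<D>(1)] unfolding U_def by blast
      have meas: "U n \<in> sets ?\<mu>" for n
        unfolding U_def using K sub[of n]
        by (auto intro!: sets.finite_UN) (metis atLeastAtMost_borel from_nat_into False)
      have "emeasure ?\<mu> A \<le> emeasure ?\<mu> (\<Union>n. U n)"
        using \<D>(4) meas \<open>\<Union>\<D> = (\<Union>n. U n)\<close> by (intro emeasure_mono) auto
      also have "\<dots> = (SUP n. emeasure ?\<mu> (U n))"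
        by (rule SUP_emeasure_incseq[symmetric])
          (use meas in \<open>force simp: incseq_def U_def intro: order.strict_trans2\<close>)+
      also have "\<dots> \<le> ennreal \<epsilon>"
        by (rule SUP_least) (use fin[OF _ sub] in \<open>simp add: U_def\<close>)
      finally show ?thesis .
    qed
  qed
  then have "emeasure ?\<mu> A \<le> 0"
    by (rule ennreal_le_epsilon[where y = 0, unfolded add_0])
  then show ?thesis by simp
qed

text \<open>
  The density is the Radon-Nikodym derivative of the Stieltjes measure of \<open>F\<close>.
\<close>

lemma mono_abs_cont01_integral:
  fixes F :: "real \<Rightarrow> real"
  assumes F: "abs_cont01 F" and mono: "\<And>x y. \<lbrakk>0 \<le> x; x \<le> y; y \<le> 1\<rbrakk> \<Longrightarrow> F x \<le> F y"
  shows "\<exists>g. g absolutely_integrable_on {0..1} \<and> (\<forall>t\<in>{0..1}. integral {0..t} g = F t - F 0)"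
proof -
  \<comment> \<open>Constant continuation of \<open>F\<close> to the real line.\<close>
  define G where "G x = F (max 0 (min 1 x))" for x
  have G_eq: "G x = F x" if "x \<in> {0..1}" for x using that by (simp add: G_def)
  have G_mono: "G x \<le> G y" if "x \<le> y" for x y
    unfolding G_def using that by (intro mono) auto
  have G_cont: "continuous_on UNIV G"
    unfolding G_def
    by (rule continuous_on_compose2[OF abs_cont01_continuous[OF F]]) (auto intro!: continuous_intros)
  let ?\<mu> = "interval_measure G"
  \<comment> \<open>The restriction to the unit interval leaves only null sets inside it to be considered.\<close>
  define M where "M = density ?\<mu> (indicator {0..1})"
  have sets_M: "sets M = sets lborel" by (simp add: M_def)
  have M_eq: "emeasure M A = emeasure ?\<mu> (A \<inter> {0..1})" if "A \<in> sets borel" for A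
    using that unfolding M_def
    by (subst emeasure_density) (auto simp: indicator_inter_arith[symmetric] Int_commute)
  have "absolutely_continuous lborel M"
    unfolding absolutely_continuous_def
  proof
    fix A :: "real set" assume "A \<in> null_sets lborel"
    then have A: "A \<in> sets borel" "emeasure lborel A = 0" by auto
    have "emeasure lborel (A \<inter> {0..1}) = 0"
      using A emeasure_mono[of "A \<inter> {0..1}" A lborel] by auto
    then have "emeasure ?\<mu> (A \<inter> {0..1}) = 0"
      using A by (intro absolutely_continuous_stieltjes_measure[OF F mono G_mono G_cont G_eq]) auto
    then show "A \<in> null_sets M" using A M_eq[OF A(1)] by (auto simp: null_sets_def sets_M)
  qed
  then obtain g0 where g0: "g0 \<in> borel_measurable lborel" "density lborel g0 = M"
    using sigma_finite_measure.Radon_Nikodym[OF sigma_finite_lborel _ sets_M] by blast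
  have M_Icc: "emeasure M {0..t} = ennreal (F t - F 0)" if "t \<in> {0..1}" for t
  proof -
    have "emeasure M {0..t} = emeasure ?\<mu> {0..t}" using that by (subst M_eq) auto
    also have "\<dots> = ennreal (G t - G 0)"
      using that G_mono G_cont by (intro emeasure_interval_measure_Icc) auto
    finally show ?thesis using that by (simp add: G_eq)
  qed
  have g0_Icc: "(\<integral>\<^sup>+ x. g0 x * indicator {0..t} x \<partial>lborel) = ennreal (F t - F 0)" if "t \<in> {0..1}" for t
    using M_Icc[OF that] g0(1) unfolding g0(2)[symmetric] by (subst (asm) emeasure_density) auto
  define g where "g x = enn2real (g0 x)" for x
  have [measurable]: "g0 \<in> borel_measurable borel" using g0(1) by simp
  have [measurable]: "g \<in> borel_measurable borel" unfolding g_def[abs_def] by measurable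
  have "AE x in lborel. g0 x * indicator {0..1} x \<noteq> \<infinity>"
    by (rule nn_integral_PInf_AE) (use g0_Icc[of 1] in auto)
  then have AE: "AE x in lborel. x \<in> {0..1} \<longrightarrow> ennreal (g x) = g0 x"
    by eventually_elim (auto simp: g_def indicator_def top.not_eq_extremum split: if_splits)
  have int: "(g has_integral (F t - F 0)) {0..t}" if t: "t \<in> {0..1}" for t
  proof -
    have "(\<integral>\<^sup>+ x. ennreal (g x * indicator {0..t} x) \<partial>lborel) = ennreal (F t - F 0)"
      unfolding g0_Icc[OF t, symmetric] using t
      by (intro nn_integral_cong_AE eventually_mono[OF AE]) (auto simp: indicator_def)
    then have "((\<lambda>x. g x * indicator {0..t} x) has_integral (F t - F 0)) UNIV"
      using mono[of 0 t] t by (intro nn_integral_has_integral) (auto simp: g_def)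
    moreover have "(\<lambda>x. g x * indicator {0..t} x) = (\<lambda>x. if x \<in> {0..t} then g x else 0)"
      by (auto simp: fun_eq_iff indicator_def)
    ultimately show ?thesis by (simp only: has_integral_restrict_UNIV)
  qed
  have "g integrable_on {0..1}" using int[of 1] by (auto simp: integrable_on_def)
  then have "g absolutely_integrable_on {0..1}"
    by (rule nonnegative_absolutely_integrable_1) (simp add: g_def)
  moreover have "\<forall>t\<in>{0..1}. integral {0..t} g = F t - F 0" using int integral_unique by blast
  ultimately show ?thesis by blast
qed

text \<open>
  Jordan decomposition: the variation of \<open>f\<close> and its difference to \<open>f\<close> are both monotone and
  absolutely continuous.
\<close>

lemma abs_cont01_real_integral:
  fixes f :: "real \<Rightarrow> real"
  assumes f: "abs_cont01 f"
  shows "\<exists>g. g absolutely_integrable_on {0..1} \<and> (\<forall>t\<in>{0..1}. integral {0..t} g = f t - f 0)"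
proof -
  let ?V = "variation_fun f"
  have V: "abs_cont01 ?V" by (rule abs_cont01_variation_fun[OF f])
  have incr: "\<bar>f y - f x\<bar> \<le> ?V y - ?V x" if "0 \<le> x" "x \<le> y" "y \<le> 1" for x y
    using dist_le_variation_fun[OF f that] by (simp add: dist_real_def abs_minus_commute)
  obtain g1 where g1: "g1 absolutely_integrable_on {0..1}" "\<forall>t\<in>{0..1}. integral {0..t} g1 = ?V t - ?V 0"
    using mono_abs_cont01_integral[OF V] incr by (smt (verit, best))
  have "abs_cont01 (\<lambda>t. ?V t + - f t)"
    by (intro abs_cont01_add V abs_cont01_linear[OF f] bounded_linear_minus bounded_linear_ident)
  then obtain g2 where g2: "g2 absolutely_integrable_on {0..1}"
    "\<forall>t\<in>{0..1}. integral {0..t} g2 = (?V t + - f t) - (?V 0 + - f 0)"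
    using mono_abs_cont01_integral[of "\<lambda>t. ?V t + - f t"] incr by (smt (verit, best))
  have "integral {0..t} (\<lambda>x. g1 x - g2 x) = f t - f 0" if t: "t \<in> {0..1}" for t
  proof -
    have "g1 integrable_on {0..t}" "g2 integrable_on {0..t}"
      using g1(1) g2(1) t by (auto intro!: integrable_on_subinterval[OF absolutely_integrable_on_def[THEN iffD1, THEN conjunct1]])
    then show ?thesis using g1(2) g2(2) t by (subst integral_diff) auto
  qed
  moreover have "(\<lambda>x. g1 x - g2 x) absolutely_integrable_on {0..1}"
    using g1(1) g2(1) by (rule set_integral_diff)
  ultimately show ?thesis by blast
qed

text \<open>
  Lebesgue's differentiation theorem on the unit interval.  Almost everywhere, the averages of an
  integrable function over intervals to the right of a point converge to its value there; for
  intervals to the left, this is applied to the reflected function.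
\<close>

lemma negligible_lebesgue_points:
  fixes g :: "real \<Rightarrow> 'a::euclidean_space"
  assumes g: "g integrable_on {0..1}"
  shows "\<exists>N. negligible N \<and> (\<forall>t\<in>{0..1} - N.
     ((\<lambda>t. integral {0..t} g) has_vector_derivative g t) (at t within {0..1}))"
proof -
  define h where "h x = (if x \<in> {0..1} then g x else 0)" for x
  have h: "h integrable_on cbox a b" for a b
    using g integrable_restrict_UNIV[of "{0..1}" g] integrable_on_subcbox[of h UNIV a b]
    by (simp add: h_def[abs_def])
  have h': "(\<lambda>x. h (- x)) integrable_on cbox a b" for a b
    using h[of "-b" "-a"] Henstock_Kurzweil_Integration.integrable_reflect_real[where f = h and a = "-b" and b = "-a"] by simp
  obtain N1 where N1: "negligible N1" "\<And>x e. \<lbrakk>x \<notin> N1; 0 < e\<rbrakk> \<Longrightarrow>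
      \<exists>d>0. \<forall>k. 0 < k \<and> k < d \<longrightarrow> norm (integral (cbox x (x + k *\<^sub>R One)) h /\<^sub>R k ^ DIM(real) - h x) < e"
    using integrable_ccontinuous_explicit[OF h] by metis
  obtain N2 where N2: "negligible N2" "\<And>x e. \<lbrakk>x \<notin> N2; 0 < e\<rbrakk> \<Longrightarrow>
      \<exists>d>0. \<forall>k. 0 < k \<and> k < d \<longrightarrow> norm (integral (cbox x (x + k *\<^sub>R One)) (\<lambda>x. h (- x)) /\<^sub>R k ^ DIM(real) - h (- x)) < e"
    using integrable_ccontinuous_explicit[OF h'] by metis
  have scale: "norm (v - k *\<^sub>R w) \<le> e * k" if "norm (v /\<^sub>R k - w) < e" "0 < k" for v w :: 'a and k e
  proof -
    have "norm (v - k *\<^sub>R w) = norm (k *\<^sub>R (v /\<^sub>R k - w))" using that(2) by (simp add: algebra_simps)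
    also have "\<dots> = k * norm (v /\<^sub>R k - w)" using that(2) by (simp only: norm_scaleR abs_of_pos)
    also have "\<dots> \<le> k * e" using that by (intro mult_left_mono) auto
    finally show ?thesis by (simp add: mult.commute)
  qed
  have "((\<lambda>t. integral {0..t} g) has_vector_derivative g t) (at t within {0..1})"
    if t: "t \<in> {0..1} - (N1 \<union> uminus ` N2)" for t
    unfolding has_vector_derivative_def has_derivative_within_alt
  proof (intro conjI allI impI)
    show "bounded_linear (\<lambda>x. x *\<^sub>R g t)" by (rule bounded_linear_scaleR_left)
  next
    fix e :: real assume "0 < e"
    have "t \<notin> N1" "- t \<notin> N2" using t by (auto simp: image_iff)
    obtain d1 where d1: "d1 > 0" "\<And>k. 0 < k \<and> k < d1 \<Longrightarrow> norm (integral {t..t + k} h /\<^sub>R k - h t) < e"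
      using N1(2)[OF \<open>t \<notin> N1\<close> \<open>0 < e\<close>] by (auto simp: cbox_interval)
    obtain d2 where d2: "d2 > 0" "\<And>k. 0 < k \<and> k < d2 \<Longrightarrow> norm (integral {-t..-t + k} (\<lambda>x. h (- x)) /\<^sub>R k - h t) < e"
      using N2(2)[OF \<open>- t \<notin> N2\<close> \<open>0 < e\<close>] by (auto simp: cbox_interval)
    have ht: "h t = g t" using t by (simp add: h_def)
    have int: "g integrable_on {0..s}" if "s \<in> {0..1}" for s
      using that by (intro integrable_on_subinterval[OF g]) auto
    have "norm (integral {0..s} g - integral {0..t} g - (s - t) *\<^sub>R g t) \<le> e * norm (s - t)"
      if s: "s \<in> {0..1}" "norm (s - t) < min d1 d2" for s
    proof -
      consider "s = t" | "t < s" | "s < t" by linarith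
      then show ?thesis
      proof cases
        case 2
        define k where "k = s - t"
        have "integral {0..s} g - integral {0..t} g = integral {t..s} g"
          using Henstock_Kurzweil_Integration.integral_combine[of 0 t s g] int[of s] s t 2
          by (auto simp: algebra_simps)
        also have "\<dots> = integral {t..s} h"
          using s t by (intro Henstock_Kurzweil_Integration.integral_cong) (auto simp: h_def)
        also have "{t..s} = {t..t + k}" by (simp add: k_def)
        finally have "integral {0..s} g - integral {0..t} g = integral {t..t + k} h" .
        moreover have "norm (integral {t..t + k} h - k *\<^sub>R h t) \<le> e * k"
          by (rule scale) (use 2 s d1(2)[of k] in \<open>auto simp: k_def\<close>)
        ultimately show ?thesis using 2 by (simp add: k_def ht)
      next
        case 3
        define k where "k = t - s"
        have "integral {0..t} g - integral {0..s} g = integral {s..t} g"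
          using Henstock_Kurzweil_Integration.integral_combine[of 0 s t g] int[of t] s t 3
          by (auto simp: algebra_simps)
        also have "\<dots> = integral {s..t} h"
          using s t by (intro Henstock_Kurzweil_Integration.integral_cong) (auto simp: h_def)
        also have "\<dots> = integral {-t..-t + k} (\<lambda>x. h (- x))"
          using integral_reflect_real[of t s h] by (simp add: k_def)
        finally have eq: "integral {0..t} g - integral {0..s} g = integral {-t..-t + k} (\<lambda>x. h (- x))" .
        have "norm (integral {0..s} g - integral {0..t} g - (s - t) *\<^sub>R g t) =
            norm (integral {0..t} g - integral {0..s} g - k *\<^sub>R h t)"
          unfolding k_def ht by (subst norm_minus_cancel[symmetric]) (simp add: algebra_simps)
        also have "\<dots> \<le> e * k"
          unfolding eq by (rule scale) (use 3 s d2(2)[of k] in \<open>auto simp: k_def\<close>)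
        finally show ?thesis using 3 by (simp add: k_def)
      qed simp
    qed
    then show "\<exists>d>0. \<forall>y\<in>{0..1}. norm (y - t) < d \<longrightarrow>
        norm (integral {0..y} g - integral {0..t} g - (y - t) *\<^sub>R g t) \<le> e * norm (y - t)"
      using d1(1) d2(1) by (intro exI[of _ "min d1 d2"]) auto
  qed
  moreover have "negligible (N1 \<union> uminus ` N2)"
    using N1(1) N2(1) by (intro negligible_Un negligible_differentiable_image_negligible) (auto intro!: derivative_intros)
  ultimately show ?thesis by blast
qed

text \<open>
  Truncation: the part of \<open>g\<close> above a large \<open>k\<close> has small integral over the whole unit interval, and
  the part below \<open>k\<close> contributes at most \<open>k\<close> times the total length of the family.
\<close>

lemma abs_cont01_integral:
  fixes g :: "real \<Rightarrow> real"
  assumes g: "g absolutely_integrable_on {0..1}" and nonneg: "\<And>t. t \<in> {0..1} \<Longrightarrow> 0 \<le> g t"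
  shows "abs_cont01 (\<lambda>t. integral {0..t} g)"
proof (rule abs_cont01_I)
  fix \<epsilon> :: real assume "\<epsilon> > 0"
  have g_int: "g integrable_on {0..1}" using g by (simp add: absolutely_integrable_on_def)
  define r where "r k t = g t - min (g t) (real k)" for k t
  have r_int: "r k integrable_on {0..1}" for k
    unfolding r_def using g
    by (intro integrable_diff g_int set_lebesgue_integral_eq_integral(1) absolutely_integrable_min_1) auto
  have r_nonneg: "0 \<le> r k t" for k t by (simp add: r_def)
  have r_lim: "(\<lambda>k. r k t) \<longlonglongrightarrow> 0" for t
  proof (rule tendsto_eventually)
    show "eventually (\<lambda>k. r k t = 0) sequentially"
      using eventually_ge_at_top[of "nat \<lceil>g t\<rceil>"]
      by eventually_elim (auto simp: r_def min_def nat_ceiling_le_eq)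
  qed
  have "(\<lambda>k. integral {0..1} (r k)) \<longlonglongrightarrow> integral {0..1} (\<lambda>t::real. 0)"
  proof (rule Equivalence_Lebesgue_Henstock_Integration.dominated_convergence(2))
    show "norm (r k t) \<le> g t" if "t \<in> {0..1}" for k t
      using nonneg[OF that] by (simp add: r_def min_def)
  qed (use r_int g_int r_lim in auto)
  then have "\<forall>\<^sub>F k in sequentially. integral {0..1} (r k) < \<epsilon> / 2"
    using \<open>\<epsilon> > 0\<close> by (intro order_tendstoD(2)) auto
  then obtain k where k: "integral {0..1} (r k) < \<epsilon> / 2"
    by (auto simp: eventually_sequentially)
  have "(\<Sum>i<n. dist (integral {0..a i} g) (integral {0..b i} g)) < \<epsilon>"
    if ab: "interval_family 0 1 {..<n::nat} a b" "(\<Sum>i<n. b i - a i) < \<epsilon> / (2 * (real k + 1))" for n a b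
  proof -
    have ab': "0 \<le> a i" "a i \<le> b i" "b i \<le> 1" if "i < n" for i
      using ab(1) that by (auto simp: interval_family_def)
    have sub: "f integrable_on {a i..b i}" if "f integrable_on {0..1}" "i < n" for f :: "real \<Rightarrow> real" and i
      using that(1) by (rule integrable_on_subinterval) (use ab'[OF that(2)] in auto)
    define \<phi> where "\<phi> i t = (if t \<in> {a i<..<b i} then r k t else 0)" for i t
    have \<phi>: "(\<phi> i has_integral integral {a i..b i} (r k)) {0..1}" if "i < n" for i
    proof -
      have "(r k has_integral integral {a i..b i} (r k)) {a i<..<b i}"
        using integrable_integral[OF sub[OF r_int that]]
        by (simp add: has_integral_Icc_iff_Ioo)
      then have "((\<lambda>t. if t \<in> {a i<..<b i} then r k t else 0) has_integral integral {a i..b i} (r k)) {0..1}"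
        by (subst has_integral_restrict) (use ab'[OF that] in auto)
      then show ?thesis by (simp add: \<phi>_def[abs_def])
    qed
    have one: "dist (integral {0..a i} g) (integral {0..b i} g) \<le> integral {a i..b i} (r k) + k * (b i - a i)"
      if i: "i < n" for i
    proof -
      have "integral {0..b i} g - integral {0..a i} g = integral {a i..b i} g"
        using Henstock_Kurzweil_Integration.integral_combine[of 0 "a i" "b i" g] ab'[OF i]
          integrable_on_subinterval[OF g_int, of 0 "b i"] by (auto simp: algebra_simps)
      moreover have "0 \<le> integral {a i..b i} g"
        using ab'[OF i] by (intro integral_nonneg sub[OF g_int i] nonneg) auto
      moreover have "integral {a i..b i} g \<le> integral {a i..b i} (\<lambda>t. r k t + k)"
        by (intro integral_le sub[OF g_int i] integrable_add sub[OF r_int i]) (auto simp: r_def)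
      moreover have "integral {a i..b i} (\<lambda>t. r k t + k) = integral {a i..b i} (r k) + k * (b i - a i)"
        using ab'[OF i] by (subst integral_add) (auto intro: sub[OF r_int i])
      ultimately show ?thesis by (simp add: dist_real_def)
    qed
    have "(\<Sum>i<n. dist (integral {0..a i} g) (integral {0..b i} g)) \<le>
      (\<Sum>i<n. integral {a i..b i} (r k) + k * (b i - a i))"
      using one by (intro sum_mono) auto
    also have "\<dots> = (\<Sum>i<n. integral {a i..b i} (r k)) + k * (\<Sum>i<n. b i - a i)"
      by (simp add: sum.distrib sum_distrib_left)
    also have "(\<Sum>i<n. integral {a i..b i} (r k)) \<le> integral {0..1} (r k)"
    proof (rule has_integral_le)
      show "((\<lambda>t. \<Sum>i<n. \<phi> i t) has_integral (\<Sum>i<n. integral {a i..b i} (r k))) {0..1}"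
        using \<phi> by (intro has_integral_sum) auto
      show "(r k has_integral integral {0..1} (r k)) {0..1}"
        using r_int by (rule integrable_integral)
      show "(\<Sum>i<n. \<phi> i t) \<le> r k t" for t
      proof (cases "\<exists>j<n. t \<in> {a j<..<b j}")
        case True
        then obtain j where j: "j < n" "t \<in> {a j<..<b j}" by blast
        have "t \<notin> {a i<..<b i}" if "i < n" "i \<noteq> j" for i
          using ab(1) that j unfolding interval_family_def disjoint_family_on_def by blast
        then have "(\<Sum>i<n. \<phi> i t) = (\<Sum>i<n. if i = j then r k t else 0)"
          using j by (intro sum.cong) (auto simp: \<phi>_def)
        then show ?thesis using j by simp
      next
        case False
        then have "(\<Sum>i<n. \<phi> i t) = 0" by (intro sum.neutral) (auto simp: \<phi>_def)
        then show ?thesis using r_nonneg by simp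
      qed
    qed
    also have "k * (\<Sum>i<n. b i - a i) \<le> k * (\<epsilon> / (2 * (real k + 1)))"
      using ab(2) by (intro mult_left_mono) auto
    also have "\<dots> \<le> \<epsilon> / 2" using \<open>\<epsilon> > 0\<close> by (simp add: field_simps)
    finally show ?thesis using k by simp
  qed
  moreover have "\<epsilon> / (2 * (real k + 1)) > 0" using \<open>\<epsilon> > 0\<close> by simp
  ultimately show "\<exists>\<delta>>0. \<forall>n a b. interval_family 0 1 {..<n::nat} a b \<longrightarrow> (\<Sum>i<n. b i - a i) < \<delta> \<longrightarrow>
     (\<Sum>i<n. dist (integral {0..a i} g) (integral {0..b i} g)) < \<epsilon>" by blast
qed

text \<open>
  This is what gives lengths of absolutely continuous curves any force: the velocity exists almost
  everywhere and determines the curve.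
\<close>

theorem abs_cont01_fundamental_theorem:
  fixes f :: "real \<Rightarrow> real ^ 'n"
  assumes "abs_cont01 f"
  shows "\<exists>g N. g absolutely_integrable_on {0..1} \<and> (\<forall>t\<in>{0..1}. f t = f 0 + integral {0..t} g) \<and>
    negligible N \<and> (\<forall>t\<in>{0..1} - N. (f has_vector_derivative g t) (at t within {0..1}))"
proof -
  have "\<exists>g. g absolutely_integrable_on {0..1} \<and> (\<forall>t\<in>{0..1}. integral {0..t} g = f t $ i - f 0 $ i)" for i
    using abs_cont01_real_integral[OF abs_cont01_linear[OF assms bounded_linear_vec_nth]] .
  then have "\<forall>i. \<exists>g. g absolutely_integrable_on {0..1} \<and> (\<forall>t\<in>{0..1}. integral {0..t} g = f t $ i - f 0 $ i)"
    by blast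
  then obtain G where "\<forall>i. G i absolutely_integrable_on {0..1} \<and>
      (\<forall>t\<in>{0..1}. integral {0..t} (G i) = f t $ i - f 0 $ i)"
    unfolding choice_iff by blast
  then have G: "\<And>i. G i absolutely_integrable_on {0..1}"
    "\<And>i t. t \<in> {0..1} \<Longrightarrow> integral {0..t} (G i) = f t $ i - f 0 $ i"
    by blast+
  define g where "g t = (\<chi> i. G i t)" for t
  have g: "g absolutely_integrable_on {0..1}"
    using G(1) by (subst absolutely_integrable_componentwise_iff) (auto simp: g_def Basis_vec_def inner_axis)
  then have g_int: "g integrable_on {0..1}" by (simp add: absolutely_integrable_on_def)
  have eq: "f t = f 0 + integral {0..t} g" if t: "t \<in> {0..1}" for t
  proof -
    have "g integrable_on {0..t}" using t by (intro integrable_on_subinterval[OF g_int]) auto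
    then have "integral {0..t} g $ i = f t $ i - f 0 $ i" for i
      using G(2)[OF t, of i] by (simp add: integral_component_eq_cart[symmetric] g_def del: integral_component_eq_cart)
    then show ?thesis by (simp add: vec_eq_iff)
  qed
  obtain N where N: "negligible N" "\<And>t. t \<in> {0..1} - N \<Longrightarrow>
     ((\<lambda>t. integral {0..t} g) has_vector_derivative g t) (at t within {0..1})"
    using negligible_lebesgue_points[OF g_int] by blast
  have "(f has_vector_derivative g t) (at t within {0..1})" if t: "t \<in> {0..1} - N" for t
  proof (rule has_vector_derivative_transform[where f = "\<lambda>t. f 0 + integral {0..t} g"])
    show "((\<lambda>t. f 0 + integral {0..t} g) has_vector_derivative g t) (at t within {0..1})"
      using has_vector_derivative_add[OF has_vector_derivative_const N(2)[OF t], of "f 0"] by simp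
    show "t \<in> {0..1}" using t by simp
  qed (rule eq)
  with g eq N(1) show ?thesis by blast
qed

section \<open>Velocity and length of curves in the Heisenberg group\<close>

lemma XYZ_nth [simp]:
  "X $ 1 = 1" "X $ 2 = 0" "X $ 3 = 0" "Y $ 1 = 0" "Y $ 2 = 1" "Y $ 3 = 0"
  "Z $ 1 = 0" "Z $ 2 = 0" "Z $ 3 = 1"
  by (simp_all add: X_def Y_def Z_def axis_def)

lemma lie_bracket_nth [simp]:
  "lie_bracket v w $ 1 = 0" "lie_bracket v w $ 2 = 0"
  "lie_bracket v w $ 3 = v $ 1 * w $ 2 - v $ 2 * w $ 1"
  by (simp_all add: lie_bracket_def)

lemma heis_eq_iff: "v = w \<longleftrightarrow> v $ 1 = w $ 1 \<and> v $ 2 = w $ 2 \<and> v $ 3 = w $ 3" for v w :: heis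
  by (simp add: vec_eq_iff forall_3)

lemma max_norm_eq: "max_norm v = max (sqrt ((v $ 1)\<^sup>2 + (v $ 2)\<^sup>2)) \<bar>v $ 3\<bar>"
  by (simp add: max_norm_def horizontal_part_def inner_vec_def sum_3 power2_eq_square)

lemma max_norm_nonneg: "0 \<le> max_norm v"
  by (simp add: max_norm_eq max_def)

lemma abs_nth_le_max_norm: "\<bar>v $ 1\<bar> \<le> max_norm v" "\<bar>v $ 2\<bar> \<le> max_norm v" "\<bar>v $ 3\<bar> \<le> max_norm v"
proof -
  have "\<bar>v $ 1\<bar> \<le> sqrt ((v $ 1)\<^sup>2 + (v $ 2)\<^sup>2)" "\<bar>v $ 2\<bar> \<le> sqrt ((v $ 1)\<^sup>2 + (v $ 2)\<^sup>2)"
    by (auto intro: real_le_rsqrt)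
  then show "\<bar>v $ 1\<bar> \<le> max_norm v" "\<bar>v $ 2\<bar> \<le> max_norm v" "\<bar>v $ 3\<bar> \<le> max_norm v"
    unfolding max_norm_eq by (simp_all only: max.coboundedI1 max.cobounded2)
qed

lemma body_velocity_eq:
  assumes "t \<in> {0..1}" "(\<gamma> has_vector_derivative g) (at t within {0..1})"
  shows "body_velocity \<gamma> t = g - (1 / 2) *\<^sub>R lie_bracket (\<gamma> t) g"
  using vector_derivative_within_closed_interval[OF _ assms] by (simp add: body_velocity_def inv_dL_eq)

lemma absolutely_integrable_mult_continuous:
  fixes f g :: "real \<Rightarrow> real"
  assumes "continuous_on {0..1} f" "g absolutely_integrable_on {0..1}"
  shows "(\<lambda>t. f t * g t) absolutely_integrable_on {0..1}"
proof (rule absolutely_integrable_bounded_measurable_product_real)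
  show "f \<in> borel_measurable (lebesgue_on {0..1})"
    using assms(1) by (rule continuous_imp_measurable_on_sets_lebesgue) auto
  show "bounded (f ` {0..1})"
    using compact_continuous_image[OF assms(1)] compact_imp_bounded by auto
qed (use assms(2) in auto)

text \<open>
  Here \<open>g\<close> is the velocity of \<open>\<gamma>\<close> in the coordinates of the vector space and \<open>b\<close> is the same velocity
  translated back to the identity, both as integrable functions that are defined everywhere.
\<close>

definition velocity_density ::
    "(real \<Rightarrow> heis) \<Rightarrow> (real \<Rightarrow> heis) \<Rightarrow> (real \<Rightarrow> heis) \<Rightarrow> real set \<Rightarrow> bool" where
  "velocity_density \<gamma> g b S \<longleftrightarrow>
     g absolutely_integrable_on {0..1} \<and> b absolutely_integrable_on {0..1} \<and> negligible S \<and>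
     (\<forall>t\<in>{0..1}. \<gamma> t = \<gamma> 0 + integral {0..t} g) \<and>
     (\<forall>t. b t = g t - (1 / 2) *\<^sub>R lie_bracket (\<gamma> t) (g t)) \<and>
     (\<forall>t\<in>{0..1} - S. (\<gamma> has_vector_derivative g t) (at t within {0..1})) \<and>
     (\<forall>t\<in>{0..1} - S. body_velocity \<gamma> t = b t)"

lemma velocity_densityD:
  assumes "velocity_density \<gamma> g b S"
  shows "g absolutely_integrable_on {0..1}" "b absolutely_integrable_on {0..1}" "negligible S"
    "\<And>t. t \<in> {0..1} \<Longrightarrow> \<gamma> t = \<gamma> 0 + integral {0..t} g"
    "\<And>t. b t = g t - (1 / 2) *\<^sub>R lie_bracket (\<gamma> t) (g t)"
    "\<And>t. t \<in> {0..1} - S \<Longrightarrow> (\<gamma> has_vector_derivative g t) (at t within {0..1})"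
    "\<And>t. t \<in> {0..1} - S \<Longrightarrow> body_velocity \<gamma> t = b t"
  using assms unfolding velocity_density_def by blast+

lemma exists_velocity_density:
  assumes "absolutely_continuous_curve \<gamma>"
  shows "\<exists>g b S. velocity_density \<gamma> g b S"
proof -
  have ac: "abs_cont01 \<gamma>" using assms by (simp add: absolutely_continuous_curve_iff)
  obtain g S where g: "g absolutely_integrable_on {0..1}" "\<forall>t\<in>{0..1}. \<gamma> t = \<gamma> 0 + integral {0..t} g"
    "negligible S" "\<forall>t\<in>{0..1} - S. (\<gamma> has_vector_derivative g t) (at t within {0..1})"
    using abs_cont01_fundamental_theorem[OF ac] by (elim exE conjE)
  have cont: "continuous_on {0..1} (\<lambda>t. \<gamma> t $ i)" for i
    using abs_cont01_continuous[OF ac] by (intro continuous_intros)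
  have comp: "(\<lambda>t. g t $ i) absolutely_integrable_on {0..1}" for i
    using absolutely_integrable_linear[OF g(1) bounded_linear_vec_nth[of i]] by (simp add: o_def)
  have "(\<lambda>t. \<gamma> t $ 1 * g t $ 2 - \<gamma> t $ 2 * g t $ 1) absolutely_integrable_on {0..1}"
    by (intro set_integral_diff absolutely_integrable_mult_continuous cont comp)
  then have "((\<lambda>r. r *\<^sub>R Z) \<circ> (\<lambda>t. \<gamma> t $ 1 * g t $ 2 - \<gamma> t $ 2 * g t $ 1)) absolutely_integrable_on {0..1}"
    by (rule absolutely_integrable_linear) (rule bounded_linear_scaleR_left)
  then have "(\<lambda>t. lie_bracket (\<gamma> t) (g t)) absolutely_integrable_on {0..1}"
    by (simp add: o_def lie_bracket_def)
  then have b: "(\<lambda>t. g t - (1 / 2) *\<^sub>R lie_bracket (\<gamma> t) (g t)) absolutely_integrable_on {0..1}"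
    using g(1) by (intro set_integral_diff absolutely_integrable_scaleR_left) auto
  have "body_velocity \<gamma> t = g t - (1 / 2) *\<^sub>R lie_bracket (\<gamma> t) (g t)" if "t \<in> {0..1} - S" for t
    using g(4) that body_velocity_eq by blast
  with g b show ?thesis unfolding velocity_density_def by blast
qed

text \<open>
  Lengths are Lebesgue integrals with values in \<^typ>\<open>ennreal\<close>, whereas the curve is recovered from its
  velocity by a gauge integral; this is the link between the two.
\<close>

lemma nn_integral_Icc_eq:
  assumes "m integrable_on {0..1::real}" "\<And>t. t \<in> {0..1} \<Longrightarrow> 0 \<le> m t"
  shows "(\<integral>\<^sup>+ t\<in>{0..1}. ennreal (m t) \<partial>lebesgue) = ennreal (integral {0..1} m)"
  using nn_integral_has_integral_lebesgue'[OF assms(2) integrable_integral[OF assms(1)]]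
  by (simp add: nn_integral_completion)

lemma curve_length_le:
  assumes "m integrable_on {0..1}" "\<And>t. t \<in> {0..1} \<Longrightarrow> 0 \<le> m t" "negligible S"
    "\<And>t. t \<in> {0..1} - S \<Longrightarrow> N (body_velocity \<gamma> t) \<le> m t"
  shows "curve_length N \<gamma> \<le> ennreal (integral {0..1} m)"
proof -
  have "AE t in lebesgue. t \<notin> S" using assms(3) by (intro AE_not_in) (simp add: negligible_iff_null_sets)
  then have "AE t in lebesgue. ennreal (N (body_velocity \<gamma> t)) * indicator {0..1} t \<le> ennreal (m t) * indicator {0..1} t"
    by eventually_elim (use assms(4) in \<open>auto simp: indicator_def intro!: ennreal_leI\<close>)
  then have "curve_length N \<gamma> \<le> (\<integral>\<^sup>+ t\<in>{0..1}. ennreal (m t) \<partial>lebesgue)"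
    unfolding curve_length_def by (rule nn_integral_mono_AE)
  then show ?thesis by (simp only: nn_integral_Icc_eq[OF assms(1,2)])
qed

lemma curve_length_ge:
  assumes "m integrable_on {0..1}" "\<And>t. t \<in> {0..1} \<Longrightarrow> 0 \<le> m t" "negligible S"
    "\<And>t. t \<in> {0..1} - S \<Longrightarrow> m t \<le> N (body_velocity \<gamma> t)"
  shows "ennreal (integral {0..1} m) \<le> curve_length N \<gamma>"
proof -
  have "AE t in lebesgue. t \<notin> S" using assms(3) by (intro AE_not_in) (simp add: negligible_iff_null_sets)
  then have "AE t in lebesgue. ennreal (m t) * indicator {0..1} t \<le> ennreal (N (body_velocity \<gamma> t)) * indicator {0..1} t"
    by eventually_elim (use assms(4) in \<open>auto simp: indicator_def intro!: ennreal_leI\<close>)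
  then have "(\<integral>\<^sup>+ t\<in>{0..1}. ennreal (m t) \<partial>lebesgue) \<le> curve_length N \<gamma>"
    unfolding curve_length_def by (rule nn_integral_mono_AE)
  then show ?thesis by (simp only: nn_integral_Icc_eq[OF assms(1,2)])
qed

section \<open>The height of a curve of given length\<close>

text \<open>
  With \<open>T = \<integral> m\<close>, the curve stays in the region where the first two coordinates are at most \<open>T\<close>.  The
  third coordinate changes at the rate \<open>b $ 3\<close> plus the rate at which the projected curve sweeps area,
  which is at most \<open>T * m\<close>.
  Measuring \<open>b $ 3\<close> relative to the plane with slopes \<open>\<alpha>\<close> and \<open>\<beta>\<close> changes nothing in the end, as the
  curve returns to the centre and \<open>\<integral> g $ 1 = \<integral> g $ 2 = 0\<close>.  This is a crude isoperimetric inequality: a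
  length of order \<open>sqrt z\<close> is needed to reach \<open>z *\<^sub>R Z\<close> when \<open>z\<close> is large.
\<close>

lemma height_bound:
  fixes g b :: "real \<Rightarrow> heis" and m :: "real \<Rightarrow> real"
  assumes g: "g absolutely_integrable_on {0..1}" and \<gamma>: "\<And>t. t \<in> {0..1} \<Longrightarrow> \<gamma> t = integral {0..t} g"
    and b: "\<And>t. b t = g t - (1 / 2) *\<^sub>R lie_bracket (\<gamma> t) (g t)"
    and m: "m integrable_on {0..1}" "\<And>t. t \<in> {0..1} \<Longrightarrow> 0 \<le> m t"
    and hor: "\<And>t. t \<in> {0..1} \<Longrightarrow> \<bar>b t $ 1\<bar> \<le> m t" "\<And>t. t \<in> {0..1} \<Longrightarrow> \<bar>b t $ 2\<bar> \<le> m t"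
    and S: "negligible S"
    and ver: "\<And>t. t \<in> {0..1} - S \<Longrightarrow> \<bar>b t $ 3 - (\<alpha> * b t $ 1 + \<beta> * b t $ 2)\<bar> \<le> K * m t"
    and "0 \<le> K" and fin: "\<gamma> 1 = z *\<^sub>R Z"
  shows "\<bar>z\<bar> \<le> K * integral {0..1} m + (integral {0..1} m)\<^sup>2"
proof -
  define T where "T = integral {0..1} m"
  have g_int: "g integrable_on {0..1}" using g by (simp add: absolutely_integrable_on_def)
  have g_nth: "(\<lambda>t. g t $ i) integrable_on {0..1}" for i
    using integrable_component[OF g_int, of "axis i 1"] by (simp add: inner_axis)
  have bg: "b t $ 1 = g t $ 1" "b t $ 2 = g t $ 2"
    "b t $ 3 = g t $ 3 - (\<gamma> t $ 1 * g t $ 2 - \<gamma> t $ 2 * g t $ 1) / 2" for t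
    by (simp_all add: b)
  have pos: "\<bar>\<gamma> t $ i\<bar> \<le> T" if t: "t \<in> {0..1}" and i: "i = 1 \<or> i = 2" for t i
  proof -
    have sub: "{0..t} \<subseteq> {0..1}" using t by auto
    have "\<bar>g s $ i\<bar> \<le> m s" if "s \<in> {0..1}" for s using hor that bg i by auto
    then have "norm (integral {0..t} (\<lambda>s. g s $ i)) \<le> integral {0..t} m"
      using sub t by (intro Henstock_Kurzweil_Integration.integral_norm_bound_integral integrable_on_subinterval[OF g_nth]
          integrable_on_subinterval[OF m(1)]) auto
    also have "\<dots> \<le> T"
      unfolding T_def using m sub t
      by (intro integral_subset_le integrable_on_subinterval[OF m(1)]) auto
    also have "integral {0..t} (\<lambda>s. g s $ i) = \<gamma> t $ i"
      using integral_component_eq_cart[OF integrable_on_subinterval[OF g_int sub]] \<gamma>[OF t] by simp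
    finally show ?thesis by simp
  qed
  define f where "f t = g t $ 3 - (\<alpha> * g t $ 1 + \<beta> * g t $ 2)" for t
  \<comment> \<open>Changing \<open>f\<close> on a null set makes the estimate hold at every point.\<close>
  define f' where "f' t = (if t \<in> S then 0 else f t)" for t
  have f: "f integrable_on {0..1}"
    unfolding f_def by (intro integrable_diff integrable_add integrable_on_mult_right g_nth)
  then have f': "f' integrable_on {0..1}"
    by (rule integrable_spike[OF _ S]) (simp add: f'_def)
  have "T \<ge> 0" unfolding T_def using m by (intro integral_nonneg) auto
  have bound: "norm (f' t) \<le> (K + T) * m t" if t: "t \<in> {0..1}" for t
  proof (cases "t \<in> S")
    case True
    then show ?thesis using m(2)[OF t] \<open>0 \<le> K\<close> \<open>T \<ge> 0\<close> by (simp add: f'_def)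
  next
    case False
    have "f t = (b t $ 3 - (\<alpha> * b t $ 1 + \<beta> * b t $ 2)) + (\<gamma> t $ 1 * b t $ 2 - \<gamma> t $ 2 * b t $ 1) / 2"
      by (simp add: f_def bg)
    moreover have "\<bar>\<gamma> t $ 1 * b t $ 2\<bar> \<le> T * m t" "\<bar>\<gamma> t $ 2 * b t $ 1\<bar> \<le> T * m t"
      unfolding abs_mult using pos[OF t] hor t \<open>T \<ge> 0\<close> by (auto intro!: mult_mono)
    moreover have "\<bar>b t $ 3 - (\<alpha> * b t $ 1 + \<beta> * b t $ 2)\<bar> \<le> K * m t" using ver t False by simp
    moreover have "\<bar>u + (v - w) / 2\<bar> \<le> p + q" if "\<bar>v\<bar> \<le> q" "\<bar>w\<bar> \<le> q" "\<bar>u\<bar> \<le> p" for u v w p q :: real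
      using that unfolding abs_le_iff by (auto simp: field_simps)
    ultimately have "\<bar>f t\<bar> \<le> K * m t + T * m t" by metis
    then show ?thesis using False by (simp add: f'_def distrib_right)
  qed
  have "f' t = f t" if "t \<in> {0..1} - S" for t using that by (simp add: f'_def)
  then have eq: "integral {0..1} f = integral {0..1} f'"
    by (intro integral_spike[OF S]) auto
  have g1: "integral {0..1} (\<lambda>t. g t $ i) = (z *\<^sub>R Z) $ i" for i
    using integral_component_eq_cart[OF g_int, of i] \<gamma>[of 1] fin by simp
  have "integral {0..1} f = integral {0..1} (\<lambda>t. g t $ 3) -
      (\<alpha> * integral {0..1} (\<lambda>t. g t $ 1) + \<beta> * integral {0..1} (\<lambda>t. g t $ 2))"
    unfolding f_def
    by (subst Henstock_Kurzweil_Integration.integral_diff Henstock_Kurzweil_Integration.integral_add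
        Henstock_Kurzweil_Integration.integral_mult_right;
        (intro integrable_diff integrable_add integrable_on_mult_right g_nth)?)+ simp
  also have "\<dots> = z" unfolding g1 by simp
  finally have "\<bar>z\<bar> = norm (integral {0..1} f')" by (simp add: eq)
  also have "\<dots> \<le> integral {0..1} (\<lambda>t. (K + T) * m t)"
    by (intro Henstock_Kurzweil_Integration.integral_norm_bound_integral f' integrable_on_mult_right m(1) bound)
  also have "\<dots> = (K + T) * T"
    unfolding T_def by simp
  finally show ?thesis unfolding T_def by (simp add: algebra_simps power2_eq_square)
qed

section \<open>Curves of finite length between points of the centre\<close>

lemma abs_cont01_C1:
  fixes \<gamma> :: "real \<Rightarrow> 'a::real_normed_vector"
  assumes deriv: "\<And>t. t \<in> {0..1} \<Longrightarrow> (\<gamma> has_vector_derivative \<gamma>' t) (at t within {0..1})"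
    and B: "\<And>t. t \<in> {0..1} \<Longrightarrow> norm (\<gamma>' t) \<le> B"
  shows "abs_cont01 \<gamma>"
proof -
  have "dist (\<gamma> x) (\<gamma> y) \<le> B * dist x y" if "x \<in> {0..1}" "y \<in> {0..1}" for x y
    unfolding dist_norm
  proof (rule differentiable_bound[where S = "{0..1}" and f' = "\<lambda>t h. h *\<^sub>R \<gamma>' t"])
    show "(\<gamma> has_derivative (\<lambda>h. h *\<^sub>R \<gamma>' t)) (at t within {0..1})" if "t \<in> {0..1}" for t
      using deriv[OF that] by (simp add: has_vector_derivative_def)
    show "onorm (\<lambda>h. h *\<^sub>R \<gamma>' t) \<le> B" if "t \<in> {0..1}" for t
    proof (rule onorm_le)
      fix h :: real
      show "norm (h *\<^sub>R \<gamma>' t) \<le> B * norm h"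
        using mult_left_mono[OF B[OF that], of "\<bar>h\<bar>"] by (simp add: mult.commute)
    qed
  qed (use that in auto)
  then show ?thesis
    using abs_cont01_comp_lipschitz[OF abs_cont01_ident, of \<gamma> B] by simp
qed

text \<open>
  The distances are finite along the centre: a planar loop that encloses the signed area \<open>z\<close>, lifted
  to a curve tangent to the plane with slopes \<open>\<alpha>\<close> and \<open>\<beta>\<close>, leads from \<open>0\<close> to \<open>z *\<^sub>R Z\<close>.
\<close>

lemma exists_loop:
  "\<exists>\<gamma> C. absolutely_continuous_curve \<gamma> \<and> \<gamma> 0 = 0 \<and> \<gamma> 1 = z *\<^sub>R Z \<and>
    (\<forall>t\<in>{0..1}. let b = body_velocity \<gamma> t in
       b $ 3 = \<alpha> * b $ 1 + \<beta> * b $ 2 \<and> \<bar>b $ 1\<bar> \<le> C \<and> \<bar>b $ 2\<bar> \<le> C)"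
proof -
  \<comment> \<open>The loop sweeps area at the rate \<open>30 * z * t\<^sup>2 * (1 - t)\<^sup>2\<close>, and \<open>30 * t\<^sup>2 * (1 - t)\<^sup>2\<close> has
    integral 1; the first summand of \<open>w\<close> is the area swept up to time \<open>t\<close>.\<close>
  define x where "x t = t - t ^ 2" for t :: real
  define y where "y t = 60 * z * (t ^ 2 - t ^ 3)" for t :: real
  define w where "w t = z * (10 * t ^ 3 - 15 * t ^ 4 + 6 * t ^ 5) + \<alpha> * x t + \<beta> * y t" for t :: real
  define x' where "x' t = 1 - 2 * t" for t :: real
  define y' where "y' t = 60 * z * (2 * t - 3 * t ^ 2)" for t :: real
  define w' where "w' t = z * (30 * t ^ 2 - 60 * t ^ 3 + 30 * t ^ 4) + \<alpha> * x' t + \<beta> * y' t" for t :: real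
  define \<gamma> where "\<gamma> t = x t *\<^sub>R X + y t *\<^sub>R Y + w t *\<^sub>R Z" for t
  define \<gamma>' where "\<gamma>' t = x' t *\<^sub>R X + y' t *\<^sub>R Y + w' t *\<^sub>R Z" for t
  have x: "(x has_real_derivative x' t) (at t within S)" for t S
    unfolding x_def x'_def by (auto intro!: derivative_eq_intros)
  have y: "(y has_real_derivative y' t) (at t within S)" for t S
    unfolding y_def y'_def by (auto intro!: derivative_eq_intros simp: power2_eq_square algebra_simps)
  have w: "(w has_real_derivative w' t) (at t within S)" for t S
    unfolding w_def w'_def
    by (rule derivative_eq_intros x y refl | simp add: algebra_simps)+
  have d: "(\<gamma> has_vector_derivative \<gamma>' t) (at t within {0..1})" for t
    unfolding \<gamma>_def[abs_def] \<gamma>'_def using x y w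
    by (auto intro!: derivative_eq_intros simp: has_real_derivative_iff_has_vector_derivative)
  have "continuous_on {0..1} \<gamma>'"
    unfolding \<gamma>'_def x'_def y'_def w'_def by (intro continuous_intros)
  then have "bounded (\<gamma>' ` {0..1})"
    using compact_continuous_image compact_imp_bounded by blast
  then obtain B where B: "\<And>t. t \<in> {0..1} \<Longrightarrow> norm (\<gamma>' t) \<le> B"
    unfolding bounded_iff by (auto simp del: atLeastAtMost_iff)
  have b: "body_velocity \<gamma> t = \<gamma>' t - (1 / 2) *\<^sub>R lie_bracket (\<gamma> t) (\<gamma>' t)" if "t \<in> {0..1}" for t
    using body_velocity_eq[OF that d] .
  have nth: "\<gamma> t $ 1 = x t" "\<gamma> t $ 2 = y t" "\<gamma>' t $ 1 = x' t" "\<gamma>' t $ 2 = y' t" "\<gamma>' t $ 3 = w' t" for t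
    by (simp_all add: \<gamma>_def \<gamma>'_def)
  have area: "w' t - (x t * y' t - y t * x' t) / 2 = \<alpha> * x' t + \<beta> * y' t" for t
    unfolding w'_def x_def y_def x'_def y'_def by (simp add: field_simps power2_eq_square power3_eq_cube power4_eq_xxxx)
  show ?thesis
  proof (intro exI[of _ \<gamma>] exI[of _ B] conjI ballI)
    show "absolutely_continuous_curve \<gamma>"
      unfolding absolutely_continuous_curve_iff using d B by (rule abs_cont01_C1)
    show "\<gamma> 0 = 0" "\<gamma> 1 = z *\<^sub>R Z"
      by (simp_all add: \<gamma>_def x_def y_def w_def)
    fix t :: real assume t: "t \<in> {0..1}"
    have "\<bar>\<gamma>' t $ 1\<bar> \<le> B" "\<bar>\<gamma>' t $ 2\<bar> \<le> B"
      using component_le_norm_cart[of "\<gamma>' t"] B[OF t] order_trans by blast+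
    then show "let b = body_velocity \<gamma> t in
       b $ 3 = \<alpha> * b $ 1 + \<beta> * b $ 2 \<and> \<bar>b $ 1\<bar> \<le> B \<and> \<bar>b $ 2\<bar> \<le> B"
      using area[of t] by (simp add: b[OF t] nth Let_def)
  qed
qed

lemma curve_length_finite:
  assumes "\<And>t. t \<in> {0..1} \<Longrightarrow> N (body_velocity \<gamma> t) \<le> C"
  shows "curve_length N \<gamma> < \<infinity>"
proof -
  have "curve_length N \<gamma> \<le> ennreal (integral {0..1} (\<lambda>_::real. \<bar>C\<bar>))"
    using assms by (intro curve_length_le[where S = "{}"]) (auto intro!: order.trans[OF assms abs_ge_self])
  also have "\<dots> < \<infinity>" by simp
  finally show ?thesis .
qed

section \<open>The Finsler distance along the centre\<close>

text \<open>
  A curve of length \<open>T\<close> to \<open>(4 * z) *\<^sub>R Z\<close> becomes a curve to \<open>z *\<^sub>R Z\<close> of length less than \<open>T / 2\<close> by a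
  definite amount.  Scaling the horizontal coordinates by \<open>s\<close> and the third one by \<open>s\<^sup>2\<close> scales the
  horizontal velocity by \<open>s\<close> and the vertical velocity by \<open>s\<^sup>2\<close>.  For the maximum norm, a vertical speed
  of \<open>s - s\<^sup>2\<close> times the old speed is then available at no cost.  It compensates for choosing
  \<open>s = 1 / 2 - \<epsilon>\<close>: the scaled curve ends below \<open>z *\<^sub>R Z\<close> by \<open>(1 - 4 * s\<^sup>2) * z\<close>, about \<open>4 * \<epsilon> * z\<close>, while
  the free vertical motion reaches up to about \<open>T / 4\<close>.  Since \<open>z\<close> is at most of order \<open>T\<^sup>2\<close>, an \<open>\<epsilon>\<close> of order
  \<open>1 / T\<close> is possible, which saves a length \<open>\<epsilon> * T\<close> that does not tend to zero.
\<close>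

lemma finsler_shrink:
  assumes \<gamma>: "\<gamma> \<in> curves_along UNIV 0 ((4 * z) *\<^sub>R Z)" and "1 \<le> z"
  shows "ennreal (2 * finsler_distance max_norm 0 (z *\<^sub>R Z) + 1 / 8) \<le> curve_length max_norm \<gamma>"
proof -
  have ac: "absolutely_continuous_curve \<gamma>" "\<gamma> 0 = 0" "\<gamma> 1 = (4 * z) *\<^sub>R Z"
    using \<gamma> by (auto simp: curves_along_def)
  obtain g b S where "velocity_density \<gamma> g b S"
    using exists_velocity_density[OF ac(1)] by blast
  note gb = velocity_densityD[OF this]
  \<comment> \<open>The speed is integrable, so every absolutely continuous curve has finite length \<open>T\<close>.\<close>
  define n where "n t = max_norm (b t)" for t
  have n_nonneg: "0 \<le> n t" for t by (simp add: n_def max_norm_nonneg)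
  have "bounded_linear horizontal_part"
    unfolding horizontal_part_def[abs_def]
    by (intro bounded_linear_add bounded_linear_scaleR_const bounded_linear_vec_nth)
  then have "(\<lambda>t. norm (horizontal_part (b t))) absolutely_integrable_on {0..1}"
    using absolutely_integrable_norm[OF absolutely_integrable_linear[OF gb(2)]] by (simp add: o_def)
  moreover have "(\<lambda>t. \<bar>b t $ 3\<bar>) absolutely_integrable_on {0..1}"
    using absolutely_integrable_abs[OF absolutely_integrable_linear[OF gb(2) bounded_linear_vec_nth[of 3]]]
    by (simp add: o_def)
  ultimately have n: "n absolutely_integrable_on {0..1}"
    unfolding n_def[abs_def] max_norm_def norm_eq_sqrt_inner[symmetric] by (rule absolutely_integrable_max_1)
  then have n_int: "n integrable_on {0..1}" by (simp add: absolutely_integrable_on_def)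
  define T where "T = integral {0..1} n"
  have "T \<ge> 0" unfolding T_def using n_int n_nonneg by (intro integral_nonneg) auto
  have len: "ennreal T \<le> curve_length max_norm \<gamma>"
    unfolding T_def using n_int n_nonneg gb(3) by (rule curve_length_ge) (simp add: n_def gb(7))
  have "\<bar>4 * z\<bar> \<le> 1 * T + T\<^sup>2"
    unfolding T_def
  proof (rule height_bound[where \<alpha> = 0 and \<beta> = 0 and b = b and S = "{}"])
    show "\<gamma> t = integral {0..t} g" if "t \<in> {0..1}" for t using gb(4)[OF that] ac(2) by simp
    show "\<bar>b t $ 1\<bar> \<le> n t" "\<bar>b t $ 2\<bar> \<le> n t" "\<bar>b t $ 3 - (0 * b t $ 1 + 0 * b t $ 2)\<bar> \<le> 1 * n t" for t
      by (simp_all add: n_def abs_nth_le_max_norm)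
  qed (use gb(1,5) n_int n_nonneg ac(3) in auto)
  then have height: "4 * z \<le> T + T\<^sup>2" using \<open>1 \<le> z\<close> by simp
  have "1 \<le> T"
  proof (rule ccontr)
    assume "\<not> 1 \<le> T"
    then have "T\<^sup>2 \<le> 1" using \<open>T \<ge> 0\<close> by (simp add: power_le_one)
    then show False using height \<open>1 \<le> z\<close> \<open>\<not> 1 \<le> T\<close> by linarith
  qed
  \<comment> \<open>Since \<open>4 * z \<le> T * (1 + T)\<close>, the missing height \<open>(1 - 4 * s\<^sup>2) * z\<close> is at most \<open>T / 8\<close>.  The rate
    \<open>\<kappa>\<close>, relative to the old speed, makes up for it over the whole curve.\<close>
  define \<epsilon> where "\<epsilon> = 1 / (8 * (1 + T))"
  define s where "s = 1 / 2 - \<epsilon>"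
  define \<kappa> where "\<kappa> = (1 - 4 * s\<^sup>2) * z / T"
  have \<epsilon>: "0 < \<epsilon>" "\<epsilon> \<le> 1 / 16" using \<open>1 \<le> T\<close> by (auto simp: \<epsilon>_def field_simps)
  then have s: "0 < s" "s \<le> 1 / 2" by (auto simp: s_def)
  have "s\<^sup>2 = 1 / 4 - \<epsilon> + \<epsilon>\<^sup>2" by (simp add: s_def power2_eq_square algebra_simps)
  then have s2: "1 - 4 * s\<^sup>2 = 4 * \<epsilon> - 4 * \<epsilon>\<^sup>2" "s - s\<^sup>2 = 1 / 4 - \<epsilon>\<^sup>2" by (auto simp: s_def)
  have \<epsilon>2: "0 \<le> \<epsilon>\<^sup>2" "\<epsilon>\<^sup>2 \<le> \<epsilon>" "\<epsilon>\<^sup>2 \<le> 1 / 8"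
    using \<epsilon> power_mono[OF \<epsilon>(2), of 2] by (auto simp: power2_eq_square mult_left_le)
  have "0 \<le> \<kappa>" unfolding \<kappa>_def s2 using \<epsilon>2 \<open>1 \<le> z\<close> \<open>1 \<le> T\<close> by simp
  have "(1 - 4 * s\<^sup>2) * z \<le> 4 * \<epsilon> * z"
    unfolding s2 using \<epsilon>2 \<open>1 \<le> z\<close> by (intro mult_right_mono) auto
  also have "\<dots> = \<epsilon> * (4 * z)" by simp
  also have "\<dots> \<le> \<epsilon> * (T + T\<^sup>2)" using height \<epsilon> by (intro mult_left_mono) auto
  also have "\<dots> = T / 8" using \<open>1 \<le> T\<close> by (simp add: \<epsilon>_def power2_eq_square field_simps)
  finally have "\<kappa> \<le> 1 / 8" using \<open>1 \<le> T\<close> by (simp add: \<kappa>_def field_simps)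
  then have \<kappa>: "\<kappa> \<le> s - s\<^sup>2" unfolding s2 using \<epsilon>2 by simp
  have \<kappa>T: "\<kappa> * T = (1 - 4 * s\<^sup>2) * z" using \<open>1 \<le> T\<close> by (simp add: \<kappa>_def)
  have sT: "s * T \<le> T / 2 - 1 / 16"
    using \<open>1 \<le> T\<close> by (simp add: s_def \<epsilon>_def field_simps)
  define \<psi> where "\<psi> v = s *\<^sub>R v + ((s\<^sup>2 - s) * v $ 3) *\<^sub>R Z" for v :: heis
  define R where "R t = integral {0..t} n" for t
  \<comment> \<open>Adding multiples of \<open>Z\<close> is harmless, as \<open>Z\<close> is central.\<close>
  define \<sigma> where "\<sigma> t = \<psi> (\<gamma> t) + (\<kappa> * R t) *\<^sub>R Z" for t
  have \<psi>: "bounded_linear \<psi>"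
    unfolding \<psi>_def[abs_def]
    by (intro bounded_linear_add bounded_linear_scaleR_const bounded_linear_const_mult bounded_linear_vec_nth
        bounded_linear_scaleR_right)
  have kZ: "bounded_linear (\<lambda>r. (\<kappa> * r) *\<^sub>R Z)"
    by (intro bounded_linear_scaleR_const bounded_linear_mult_right)
  have \<psi>_nth: "\<psi> v $ 1 = s * v $ 1" "\<psi> v $ 2 = s * v $ 2" "\<psi> v $ 3 = s\<^sup>2 * v $ 3" for v
    by (simp_all add: \<psi>_def algebra_simps)
  have ac\<sigma>: "abs_cont01 \<sigma>"
    unfolding \<sigma>_def[abs_def]
    using abs_cont01_add[OF abs_cont01_linear[OF ac(1)[unfolded absolutely_continuous_curve_iff] \<psi>]
        abs_cont01_linear[OF abs_cont01_integral[OF n n_nonneg] kZ]] by (simp add: R_def)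
  obtain S' where S': "negligible S'"
    "\<And>t. t \<in> {0..1} - S' \<Longrightarrow> (R has_vector_derivative n t) (at t within {0..1})"
    using negligible_lebesgue_points[OF n_int] unfolding R_def[abs_def] by blast
  have "\<sigma> 0 = 0" using ac(2) by (simp add: \<sigma>_def R_def \<psi>_def)
  moreover have "\<sigma> 1 = z *\<^sub>R Z"
    using \<kappa>T unfolding heis_eq_iff by (simp add: \<sigma>_def R_def \<psi>_nth ac(3) T_def[symmetric] algebra_simps)
  ultimately have mem: "\<sigma> \<in> curves_along UNIV 0 (z *\<^sub>R Z)"
    using ac\<sigma> by (simp add: curves_along_def absolutely_continuous_curve_iff)
  have "max_norm (body_velocity \<sigma> t) \<le> s * n t" if t: "t \<in> {0..1} - (S \<union> S')" for t
  proof -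
    define g' where "g' = \<psi> (g t) + (\<kappa> * n t) *\<^sub>R Z"
    have "(\<sigma> has_vector_derivative g') (at t within {0..1})"
      unfolding \<sigma>_def[abs_def] g'_def using gb(6) S'(2) t
      by (intro has_vector_derivative_add bounded_linear.has_vector_derivative[OF \<psi>]
          bounded_linear.has_vector_derivative[OF kZ]) auto
    then have b': "body_velocity \<sigma> t = g' - (1 / 2) *\<^sub>R lie_bracket (\<sigma> t) g'"
      using t by (intro body_velocity_eq) auto
    have nth: "body_velocity \<sigma> t $ 1 = s * b t $ 1" "body_velocity \<sigma> t $ 2 = s * b t $ 2"
      "body_velocity \<sigma> t $ 3 = s\<^sup>2 * b t $ 3 + \<kappa> * n t"
      unfolding b' g'_def \<sigma>_def by (simp_all add: \<psi>_nth gb(5) algebra_simps power2_eq_square)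
    have "sqrt ((s * b t $ 1)\<^sup>2 + (s * b t $ 2)\<^sup>2) = s * sqrt ((b t $ 1)\<^sup>2 + (b t $ 2)\<^sup>2)"
      using s by (simp add: power_mult_distrib distrib_left[symmetric] real_sqrt_mult)
    also have "\<dots> \<le> s * n t" using s by (intro mult_left_mono) (auto simp: n_def max_norm_eq)
    finally have 1: "sqrt ((s * b t $ 1)\<^sup>2 + (s * b t $ 2)\<^sup>2) \<le> s * n t" .
    have "\<bar>s\<^sup>2 * b t $ 3\<bar> \<le> s\<^sup>2 * n t"
      unfolding abs_mult by (intro mult_mono) (auto simp: n_def abs_nth_le_max_norm)
    moreover have "0 \<le> \<kappa> * n t" "\<kappa> * n t \<le> (s - s\<^sup>2) * n t"
      using \<open>0 \<le> \<kappa>\<close> \<kappa> n_nonneg by (auto intro: mult_right_mono)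
    ultimately have "\<bar>s\<^sup>2 * b t $ 3 + \<kappa> * n t\<bar> \<le> s * n t" by (simp add: algebra_simps)
    with 1 show ?thesis unfolding max_norm_eq nth by simp
  qed
  then have "curve_length max_norm \<sigma> \<le> ennreal (integral {0..1} (\<lambda>t. s * n t))"
    using n_int n_nonneg s gb(3) S'(1)
    by (intro curve_length_le[where S = "S \<union> S'"] integrable_on_mult_right negligible_Un) auto
  also have "integral {0..1} (\<lambda>t. s * n t) = s * T" by (simp add: T_def)
  finally have "(INF \<gamma>\<in>curves_along UNIV 0 (z *\<^sub>R Z). curve_length max_norm \<gamma>) \<le> ennreal (s * T)"
    by (rule INF_lower2[OF mem])
  then have "finsler_distance max_norm 0 (z *\<^sub>R Z) \<le> s * T"
    unfolding finsler_distance_def length_distance_def using s \<open>1 \<le> T\<close>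
    by (intro enn2real_leI) auto
  then have "2 * finsler_distance max_norm 0 (z *\<^sub>R Z) + 1 / 8 \<le> T" using sT by simp
  then show ?thesis using len ennreal_leI order_trans by blast
qed

lemma finsler_gap:
  assumes "1 \<le> z"
  shows "2 * finsler_distance max_norm 0 (z *\<^sub>R Z) + 1 / 8 \<le> finsler_distance max_norm 0 ((4 * z) *\<^sub>R Z)"
proof -
  let ?I = "INF \<gamma>\<in>curves_along UNIV 0 ((4 * z) *\<^sub>R Z). curve_length max_norm \<gamma>"
  have low: "ennreal (2 * finsler_distance max_norm 0 (z *\<^sub>R Z) + 1 / 8) \<le> ?I"
    by (intro INF_greatest finsler_shrink assms)
  obtain \<gamma> C where \<gamma>: "absolutely_continuous_curve \<gamma>" "\<gamma> 0 = 0" "\<gamma> 1 = (4 * z) *\<^sub>R Z"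
    "\<forall>t\<in>{0..1}. let b = body_velocity \<gamma> t in
       b $ 3 = 0 * b $ 1 + 0 * b $ 2 \<and> \<bar>b $ 1\<bar> \<le> C \<and> \<bar>b $ 2\<bar> \<le> C"
    using exists_loop[of "4 * z" 0 0] by blast
  have "curve_length max_norm \<gamma> < \<infinity>"
  proof (rule curve_length_finite)
    fix t :: real assume "t \<in> {0..1}"
    then have "body_velocity \<gamma> t $ 3 = 0" "\<bar>body_velocity \<gamma> t $ 1\<bar> \<le> C" "\<bar>body_velocity \<gamma> t $ 2\<bar> \<le> C"
      using \<gamma>(4) by (auto simp: Let_def)
    then show "max_norm (body_velocity \<gamma> t) \<le> C + C"
      using sqrt_sum_squares_le_sum_abs[of "body_velocity \<gamma> t $ 1" "body_velocity \<gamma> t $ 2"]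
      by (simp add: max_norm_eq)
  qed
  moreover have "?I \<le> curve_length max_norm \<gamma>"
    by (rule INF_lower) (use \<gamma> in \<open>auto simp: curves_along_def\<close>)
  ultimately have "?I < top" by (simp add: order.strict_trans1)
  moreover have "0 \<le> 2 * finsler_distance max_norm 0 (z *\<^sub>R Z) + 1 / 8"
    by (simp add: finsler_distance_def length_distance_def)
  note enn2real_ennreal[OF this]
  ultimately show ?thesis
    using enn2real_mono[OF low]
    unfolding finsler_distance_def[of max_norm] length_distance_def[of UNIV max_norm 0 "(4 * z) *\<^sub>R Z"] by metis
qed

section \<open>Carnot metrics along the centre\<close>

text \<open>
  All layers from the second on are spanned by brackets, hence lie in the centre.  So the first layer
  and \<open>Z\<close> span everything, brackets of the first layer produce \<open>Z\<close>, and by uniqueness of the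
  decomposition \<open>Z\<close> is not in the first layer.  The first layer is therefore the graph of a linear
  functional over the horizontal plane.
\<close>

lemma stratification_first_layer:
  assumes "stratification s V"
  obtains \<alpha> \<beta> where "V 1 = {v. v $ 3 = \<alpha> * v $ 1 + \<beta> * v $ 2}"
proof -
  have s1: "1 \<le> s" and sub: "\<And>i. i \<in> {1..s} \<Longrightarrow> subspace (V i)"
    and ex: "\<And>x. \<exists>!f. f \<in> (\<Pi>\<^sub>E i\<in>{1..s}. V i) \<and> x = (\<Sum>i\<in>{1..s}. f i)"
    and br: "\<And>i. i \<in> {1..s} \<Longrightarrow> span {lie_bracket v w |v w. v \<in> V 1 \<and> w \<in> V i} = V (Suc i)"
    and last: "V (Suc s) = {0}"
    using assms unfolding stratification_def by auto
  have sub1: "subspace (V 1)" using sub s1 by auto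
  have centre: "V (Suc i) \<subseteq> span {Z}" if "i \<in> {1..s}" for i
  proof -
    have "{lie_bracket v w |v w. v \<in> V 1 \<and> w \<in> V i} \<subseteq> span {Z}"
      by (auto simp: lie_bracket_def intro: span_mul span_base)
    then show ?thesis unfolding br[OF that, symmetric] by (rule span_minimal[OF _ subspace_span])
  qed
  have decomp: "\<exists>u\<in>V 1. \<exists>c. x = u + c *\<^sub>R Z" for x
  proof -
    obtain f where f: "f \<in> (\<Pi>\<^sub>E i\<in>{1..s}. V i)" "x = (\<Sum>i\<in>{1..s}. f i)" using ex[of x] by blast
    have "(\<Sum>i\<in>{2..s}. f i) \<in> span {Z}"
    proof (rule span_sum)
      fix i assume "i \<in> {2..s}"
      then have "i - 1 \<in> {1..s}" "Suc (i - 1) = i" "i \<in> {1..s}" by auto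
      then show "f i \<in> span {Z}" using centre[of "i - 1"] f(1) by (auto simp: PiE_iff)
    qed
    then obtain c where "(\<Sum>i\<in>{2..s}. f i) = c *\<^sub>R Z" by (auto simp: span_singleton)
    moreover have "x = f 1 + (\<Sum>i\<in>{2..s}. f i)"
      using f(2) s1 by (simp add: sum.atLeast_Suc_atMost numeral_2_eq_2)
    moreover have "f 1 \<in> V 1" using f(1) s1 by (auto simp: PiE_iff)
    ultimately show ?thesis by (intro bexI[of _ "f 1"] exI[of _ c]) auto
  qed
  obtain u1 c1 where u1: "u1 \<in> V 1" "X = u1 + c1 *\<^sub>R Z" using decomp by blast
  obtain u2 c2 where u2: "u2 \<in> V 1" "Y = u2 + c2 *\<^sub>R Z" using decomp by blast
  have e1: "u1 = X - c1 *\<^sub>R Z" and e2: "u2 = Y - c2 *\<^sub>R Z" using u1(2) u2(2) by (simp_all add: algebra_simps)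
  have "lie_bracket u1 u2 = Z" unfolding e1 e2 by (simp add: heis_eq_iff)
  moreover have "lie_bracket u1 u2 \<in> span {lie_bracket v w |v w. v \<in> V 1 \<and> w \<in> V 1}"
    using u1(1) u2(1) by (intro span_base) blast
  ultimately have Z2: "Z \<in> V 2" using br[of 1] s1 by (simp add: numeral_2_eq_2)
  have "Z \<noteq> 0" by (simp add: heis_eq_iff)
  then have s2: "2 \<le> s" using Z2 last s1 by (cases "s = 1") (auto simp: numeral_2_eq_2)
  have Z1: "Z \<notin> V 1"
  proof
    assume "Z \<in> V 1"
    \<comment> \<open>Otherwise \<open>Z\<close> would have two decompositions, one in the first and one in the second layer.\<close>
    define f where "f j = (\<lambda>i\<in>{1..s}. if i = j then Z else 0)" for j :: nat
    have "f j \<in> (\<Pi>\<^sub>E i\<in>{1..s}. V i)" if "j = 1 \<or> j = 2" for j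
      using that \<open>Z \<in> V 1\<close> Z2 subspace_0[OF sub] unfolding f_def by (auto simp: PiE_iff)
    moreover have "Z = (\<Sum>i\<in>{1..s}. f j i)" if "j = 1 \<or> j = 2" for j
      using that s1 s2 by (auto simp: f_def sum.delta)
    ultimately have "f 1 = f 2" using ex[of Z] by blast
    then have "f 1 1 = f 2 1" by simp
    then show False using s1 \<open>Z \<noteq> 0\<close> by (simp add: f_def)
  qed
  have Zc: "c = 0" if "c *\<^sub>R Z \<in> V 1" for c
  proof (rule ccontr)
    assume "c \<noteq> 0"
    then have "Z = (1 / c) *\<^sub>R (c *\<^sub>R Z)" by simp
    then show False using Z1 subspace_scale[OF sub1 that, of "1 / c"] by simp
  qed
  show ?thesis
  proof (rule that[of "- c1" "- c2"], intro set_eqI iffI)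
    fix v assume v: "v \<in> V 1"
    define r where "r = v $ 3 - (- c1 * v $ 1 - c2 * v $ 2)"
    have "v - (v $ 1 *\<^sub>R u1 + v $ 2 *\<^sub>R u2) \<in> V 1"
      by (intro subspace_diff subspace_add subspace_scale sub1 v u1 u2)
    also have "v - (v $ 1 *\<^sub>R u1 + v $ 2 *\<^sub>R u2) = r *\<^sub>R Z"
      unfolding e1 e2 r_def by (simp add: heis_eq_iff)
    finally have "r = 0" by (rule Zc)
    then show "v \<in> {v. v $ 3 = - c1 * v $ 1 + - c2 * v $ 2}" by (simp add: r_def)
  next
    fix v :: heis assume "v \<in> {v. v $ 3 = - c1 * v $ 1 + - c2 * v $ 2}"
    then have "v = v $ 1 *\<^sub>R u1 + v $ 2 *\<^sub>R u2" unfolding e1 e2 by (simp add: heis_eq_iff)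
    also have "\<dots> \<in> V 1" by (intro subspace_add subspace_scale sub1 u1 u2)
    finally show "v \<in> V 1" .
  qed
qed

text \<open>
  Norms on a plane are equivalent.  The norm is carried over to \<^typ>\<open>real \<times> real\<close>, where it is Lipschitz
  and attains a positive minimum on the unit sphere.
\<close>

lemma norm_on_plane_bounds:
  fixes \<alpha> \<beta> :: real
  defines "V \<equiv> {v :: heis. v $ 3 = \<alpha> * v $ 1 + \<beta> * v $ 2}"
  assumes N: "norm_on V N"
  shows "\<exists>c C. 0 < c \<and> (\<forall>v\<in>V. c * max \<bar>v $ 1\<bar> \<bar>v $ 2\<bar> \<le> N v \<and> N v \<le> C * max \<bar>v $ 1\<bar> \<bar>v $ 2\<bar>)"
proof -
  \<comment> \<open>The plane is parametrised by its basis \<open>e1, e2\<close>, which projects to \<open>X, Y\<close>.\<close>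
  define e1 where "e1 = X + \<alpha> *\<^sub>R Z"
  define e2 where "e2 = Y + \<beta> *\<^sub>R Z"
  define E where "E p = fst p *\<^sub>R e1 + snd p *\<^sub>R e2" for p :: "real \<times> real"
  have E_nth: "E p $ 1 = fst p" "E p $ 2 = snd p" "E p $ 3 = \<alpha> * fst p + \<beta> * snd p" for p
    by (simp_all add: E_def e1_def e2_def)
  have EV: "E p \<in> V" for p by (simp add: V_def E_nth)
  have E_lin: "E (p + q) = E p + E q" "E (r *\<^sub>R p) = r *\<^sub>R E p" for p q r
    by (simp_all add: E_def algebra_simps)
  have N0: "0 \<le> N (E p)" and Nz: "N (E p) = 0 \<longleftrightarrow> E p = 0" and Ns: "N (r *\<^sub>R E p) = \<bar>r\<bar> * N (E p)"
    and Nt: "N (E p + E q) \<le> N (E p) + N (E q)" for p q r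
    using N EV unfolding norm_on_def by auto
  define C where "C = N (E (1, 0)) + N (E (0, 1))"
  have upper: "N (E p) \<le> C * max \<bar>fst p\<bar> \<bar>snd p\<bar>" for p
  proof -
    have "E p = fst p *\<^sub>R E (1, 0) + snd p *\<^sub>R E (0, 1)" by (simp add: E_def)
    then have "N (E p) \<le> N (E (fst p *\<^sub>R (1, 0))) + N (E (snd p *\<^sub>R (0, 1)))"
      by (metis E_lin(2) Nt)
    also have "\<dots> = \<bar>fst p\<bar> * N (E (1, 0)) + \<bar>snd p\<bar> * N (E (0, 1))"
      by (simp only: E_lin Ns)
    also have "\<dots> \<le> max \<bar>fst p\<bar> \<bar>snd p\<bar> * N (E (1, 0)) + max \<bar>fst p\<bar> \<bar>snd p\<bar> * N (E (0, 1))"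
      using N0 by (intro add_mono mult_right_mono) auto
    finally show ?thesis by (simp add: C_def algebra_simps)
  qed
  have "C \<ge> 0" using N0 by (simp add: C_def)
  have max_le: "max \<bar>fst p\<bar> \<bar>snd p\<bar> \<le> norm p" for p :: "real \<times> real"
    using norm_fst_le[of "fst p" "snd p"] norm_snd_le[of "snd p" "fst p"] by simp
  have "C-lipschitz_on (sphere 0 1) (\<lambda>p. N (E p))"
  proof (rule lipschitz_onI)
    have "N (E p) - N (E q) \<le> C * dist p q" for p q
    proof -
      have "N (E p) \<le> N (E q) + N (E (p - q))" using Nt[of q "p - q"] E_lin(1)[of q "p - q"] by simp
      also have "N (E (p - q)) \<le> C * norm (p - q)"
        using upper[of "p - q"] mult_left_mono[OF max_le[of "p - q"] \<open>C \<ge> 0\<close>] by linarith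
      finally show ?thesis by (simp add: dist_norm)
    qed
    from this this show "dist (N (E p)) (N (E q)) \<le> C * dist p q" for p q
      by (simp add: dist_real_def abs_le_iff) (metis dist_commute)
  qed (rule \<open>C \<ge> 0\<close>)
  then have cont: "continuous_on (sphere 0 1) (\<lambda>p. N (E p))" by (rule lipschitz_on_continuous_on)
  have "(1, 0) \<in> sphere (0 :: real \<times> real) 1" by simp
  then obtain p0 where p0: "p0 \<in> sphere 0 1" "\<And>p. p \<in> sphere 0 1 \<Longrightarrow> N (E p0) \<le> N (E p)"
    using continuous_attains_inf[OF compact_sphere _ cont] by blast
  have "E p0 \<noteq> 0"
  proof
    assume "E p0 = 0"
    then have "p0 = 0" using E_nth[of p0] by (simp add: prod_eq_iff)
    then show False using p0(1) by simp
  qed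
  then have c: "0 < N (E p0)" using N0[of p0] Nz[of p0] by simp
  have lower: "N (E p0) * max \<bar>fst p\<bar> \<bar>snd p\<bar> \<le> N (E p)" for p
  proof (cases "p = 0")
    case True
    then show ?thesis using N0[of p] by simp
  next
    case False
    have "N (E p0) * norm p \<le> N (E ((1 / norm p) *\<^sub>R p)) * norm p"
      using False by (intro mult_right_mono p0(2)) auto
    also have "\<dots> = N (E p)" unfolding E_lin Ns using False by simp
    finally show ?thesis using mult_left_mono[OF max_le[of p], of "N (E p0)"] c by linarith
  qed
  have "E (v $ 1, v $ 2) = v" if "v \<in> V" for v
    using that by (simp add: heis_eq_iff E_nth V_def)
  then show ?thesis using c lower upper by (metis fst_conv snd_conv)
qed

text \<open>
  The function \<open>f\<close> is arbitrary because it will be a norm composed with a velocity, whose measurability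
  is not part of the definition of length.  The integral is a supremum over simple functions, and those
  below \<open>c * f\<close> are \<open>c\<close> times those below \<open>f\<close>.
\<close>

lemma nn_integral_cmult_le:
  assumes "0 < c"
  shows "(\<integral>\<^sup>+ x. ennreal c * f x \<partial>M) \<le> ennreal c * (\<integral>\<^sup>+ x. f x \<partial>M)"
  unfolding nn_integral_def[of M "\<lambda>x. ennreal c * f x"]
proof (rule SUP_least)
  fix h assume "h \<in> {g. simple_function M g \<and> g \<le> (\<lambda>x. ennreal c * f x)}"
  then have h: "simple_function M h" "\<And>x. h x \<le> ennreal c * f x" by (auto simp: le_fun_def)
  have inv: "ennreal c * (ennreal (1 / c) * y) = y" "ennreal (1 / c) * (ennreal c * y) = y" for y
    using assms by (simp_all add: mult.assoc[symmetric] ennreal_mult[symmetric])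
  have [measurable]: "h \<in> borel_measurable M" using h(1) by (rule borel_measurable_simple_function)
  have "integral\<^sup>S M h = (\<integral>\<^sup>+ x. h x \<partial>M)" using h(1) by (rule nn_integral_eq_simple_integral[symmetric])
  also have "\<dots> = (\<integral>\<^sup>+ x. ennreal c * (ennreal (1 / c) * h x) \<partial>M)" by (simp add: inv)
  also have "\<dots> = ennreal c * (\<integral>\<^sup>+ x. ennreal (1 / c) * h x \<partial>M)" by (rule nn_integral_cmult) measurable
  also have "\<dots> \<le> ennreal c * (\<integral>\<^sup>+ x. f x \<partial>M)"
  proof (intro mult_left_mono nn_integral_mono)
    show "ennreal (1 / c) * h x \<le> f x" for x
      using mult_left_mono[OF h(2)[of x], of "ennreal (1 / c)"] by (simp add: inv)
  qed simp
  finally show "integral\<^sup>S M h \<le> ennreal c * (\<integral>\<^sup>+ x. f x \<partial>M)" .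
qed

lemma AE_negligible:
  assumes "AE t in lebesgue. P t"
  obtains S where "negligible S" "\<And>t. t \<notin> S \<Longrightarrow> P t"
proof -
  obtain S where S: "{t \<in> space lebesgue. \<not> P t} \<subseteq> S" "emeasure lebesgue S = 0" "S \<in> sets lebesgue"
    using AE_E[OF assms] .
  then have "negligible S" by (auto simp: negligible_iff_null_sets null_sets_def)
  with S(1) show ?thesis by (intro that[of S]) auto
qed

context
  fixes \<alpha> \<beta> :: real and N :: "heis \<Rightarrow> real" and V :: "heis set"
  defines "V \<equiv> {v :: heis. v $ 3 = \<alpha> * v $ 1 + \<beta> * v $ 2}"
  assumes N: "norm_on V N"
begin

lemma carnot_finite: "(INF \<gamma>\<in>curves_along V 0 (z *\<^sub>R Z). curve_length N \<gamma>) < top"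
proof -
  obtain c K where cK: "\<forall>v\<in>V. c * max \<bar>v $ 1\<bar> \<bar>v $ 2\<bar> \<le> N v \<and> N v \<le> K * max \<bar>v $ 1\<bar> \<bar>v $ 2\<bar>"
    using norm_on_plane_bounds[OF N[unfolded V_def]] unfolding V_def by blast
  obtain \<gamma> C where \<gamma>: "absolutely_continuous_curve \<gamma>" "\<gamma> 0 = 0" "\<gamma> 1 = z *\<^sub>R Z"
    "\<forall>t\<in>{0..1}. let b = body_velocity \<gamma> t in
       b $ 3 = \<alpha> * b $ 1 + \<beta> * b $ 2 \<and> \<bar>b $ 1\<bar> \<le> C \<and> \<bar>b $ 2\<bar> \<le> C"
    using exists_loop[of z \<alpha> \<beta>] by blast
  have bV: "body_velocity \<gamma> t \<in> V" if "t \<in> {0..1}" for t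
    using \<gamma>(4) that by (auto simp: Let_def V_def)
  have "curve_length N \<gamma> < \<infinity>"
  proof (rule curve_length_finite)
    fix t :: real assume t: "t \<in> {0..1}"
    have "N (body_velocity \<gamma> t) \<le> K * max \<bar>body_velocity \<gamma> t $ 1\<bar> \<bar>body_velocity \<gamma> t $ 2\<bar>"
      using cK bV[OF t] by blast
    also have "\<dots> \<le> \<bar>K\<bar> * C"
      using \<gamma>(4) t by (intro mult_mono) (auto simp: Let_def)
    finally show "N (body_velocity \<gamma> t) \<le> \<bar>K\<bar> * C" .
  qed
  moreover have "(INF \<gamma>\<in>curves_along V 0 (z *\<^sub>R Z). curve_length N \<gamma>) \<le> curve_length N \<gamma>"
    by (rule INF_lower) (use \<gamma> bV in \<open>auto simp: curves_along_def\<close>)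
  ultimately show ?thesis by (simp add: order.strict_trans1)
qed

lemma carnot_lower_bound:
  "\<exists>c>0. \<forall>z\<ge>0. c * sqrt z \<le> length_distance V N 0 (z *\<^sub>R Z)"
proof -
  obtain c where c: "0 < c" "\<And>v. v \<in> V \<Longrightarrow> c * max \<bar>v $ 1\<bar> \<bar>v $ 2\<bar> \<le> N v"
    using norm_on_plane_bounds[OF N[unfolded V_def]] unfolding V_def by blast
  have "c * sqrt z \<le> length_distance V N 0 (z *\<^sub>R Z)" if "z \<ge> 0" for z
  proof -
    have "ennreal (c * sqrt z) \<le> curve_length N \<gamma>" if \<gamma>: "\<gamma> \<in> curves_along V 0 (z *\<^sub>R Z)" for \<gamma>
    proof -
      have ac: "absolutely_continuous_curve \<gamma>" "\<gamma> 0 = 0" "\<gamma> 1 = z *\<^sub>R Z"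
        and AE: "AE t in lebesgue. t \<in> {0..1} \<longrightarrow> body_velocity \<gamma> t \<in> V"
        using \<gamma> by (auto simp: curves_along_def)
      obtain g b S where "velocity_density \<gamma> g b S"
    using exists_velocity_density[OF ac(1)] by blast
  note gb = velocity_densityD[OF this]
      obtain S' where S': "negligible S'" "\<And>t. t \<notin> S' \<Longrightarrow> t \<in> {0..1} \<longrightarrow> body_velocity \<gamma> t \<in> V"
        using AE_negligible[OF AE] by blast
      have bV: "b t \<in> V" if "t \<in> {0..1} - (S \<union> S')" for t
        using S'(2)[of t] gb(7)[of t] that by auto
      define m where "m t = max \<bar>b t $ 1\<bar> \<bar>b t $ 2\<bar>" for t
      have "(\<lambda>t. \<bar>b t $ i\<bar>) absolutely_integrable_on {0..1}" for i
        using absolutely_integrable_abs[OF absolutely_integrable_linear[OF gb(2) bounded_linear_vec_nth[of i]]]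
        by (simp add: o_def)
      then have "m absolutely_integrable_on {0..1}"
        unfolding m_def[abs_def] by (intro absolutely_integrable_max_1)
      then have m: "m integrable_on {0..1}" by (simp add: absolutely_integrable_on_def)
      define T where "T = integral {0..1} m"
      have "T \<ge> 0" unfolding T_def using m by (intro integral_nonneg) (auto simp: m_def)
      have "\<bar>z\<bar> \<le> 0 * T + T\<^sup>2"
        unfolding T_def
      proof (rule height_bound[where \<alpha> = \<alpha> and \<beta> = \<beta> and b = b and S = "S \<union> S'"])
        show "\<gamma> t = integral {0..t} g" if "t \<in> {0..1}" for t using gb(4)[OF that] ac(2) by simp
        show "\<bar>b t $ 3 - (\<alpha> * b t $ 1 + \<beta> * b t $ 2)\<bar> \<le> 0 * m t" if "t \<in> {0..1} - (S \<union> S')" for t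
          using bV[OF that] by (simp add: V_def)
      qed (use gb S' m ac in \<open>auto simp: m_def\<close>)
      then have "sqrt z \<le> T" using \<open>T \<ge> 0\<close> real_le_lsqrt by simp
      then have "ennreal (c * sqrt z) \<le> ennreal (c * T)" using c(1) by (intro ennreal_leI mult_left_mono) auto
      also have "c * T = integral {0..1} (\<lambda>t. c * m t)" by (simp add: T_def)
      also have "ennreal \<dots> \<le> curve_length N \<gamma>"
      proof (rule curve_length_ge)
        show "negligible (S \<union> S')" using gb(3) S'(1) by (rule negligible_Un)
        show "c * m t \<le> N (body_velocity \<gamma> t)" if "t \<in> {0..1} - (S \<union> S')" for t
          using c(2)[OF bV[OF that]] gb(7)[of t] that by (simp add: m_def)
        show "(\<lambda>t. c * m t) integrable_on {0..1}" using m by (rule integrable_on_mult_right)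
        show "0 \<le> c * m t" for t using c(1) by (simp add: m_def)
      qed
      finally show ?thesis .
    qed
    then have "ennreal (c * sqrt z) \<le> (INF \<gamma>\<in>curves_along V 0 (z *\<^sub>R Z). curve_length N \<gamma>)"
      by (rule INF_greatest)
    from enn2real_mono[OF this carnot_finite] show ?thesis
      using c(1) that by (simp add: length_distance_def)
  qed
  then show ?thesis using c(1) by blast
qed

text \<open>
  The map \<open>\<psi>\<close> is the dilation of the stratification with factor 2.  It is an automorphism of the Lie
  algebra, multiplies the first layer by 2 and the centre by 4, and so doubles the length of
  every curve tangent to the first layer.
\<close>

lemma carnot_dilate:
  assumes \<gamma>: "\<gamma> \<in> curves_along V 0 (z *\<^sub>R Z)"
  shows "\<exists>\<sigma>\<in>curves_along V 0 ((4 * z) *\<^sub>R Z). curve_length N \<sigma> \<le> ennreal 2 * curve_length N \<gamma>"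
proof -
  have ac: "absolutely_continuous_curve \<gamma>" "\<gamma> 0 = 0" "\<gamma> 1 = z *\<^sub>R Z"
    and AE: "AE t in lebesgue. t \<in> {0..1} \<longrightarrow> body_velocity \<gamma> t \<in> V"
    using \<gamma> by (auto simp: curves_along_def)
  obtain g b S where "velocity_density \<gamma> g b S"
    using exists_velocity_density[OF ac(1)] by blast
  note gb = velocity_densityD[OF this]
  define \<psi> where "\<psi> v = 2 *\<^sub>R v + (2 * (v $ 3 - \<alpha> * v $ 1 - \<beta> * v $ 2)) *\<^sub>R Z" for v :: heis
  have \<psi>: "bounded_linear \<psi>"
    unfolding \<psi>_def[abs_def]
    by (intro bounded_linear_add bounded_linear_scaleR_const bounded_linear_const_mult bounded_linear_sub
        bounded_linear_vec_nth bounded_linear_scaleR_right)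
  have \<psi>V: "\<psi> v = 2 *\<^sub>R v" if "v \<in> V" for v
    using that by (simp add: \<psi>_def V_def)
  define \<sigma> where "\<sigma> t = \<psi> (\<gamma> t)" for t
  have body: "body_velocity \<sigma> t = \<psi> (body_velocity \<gamma> t)" if t: "t \<in> {0..1} - S" for t
  proof -
    have "(\<sigma> has_vector_derivative \<psi> (g t)) (at t within {0..1})"
      unfolding \<sigma>_def[abs_def] by (rule bounded_linear.has_vector_derivative[OF \<psi> gb(6)[OF t]])
    then have "body_velocity \<sigma> t = \<psi> (g t) - (1 / 2) *\<^sub>R lie_bracket (\<sigma> t) (\<psi> (g t))"
      using t by (intro body_velocity_eq) auto
    also have "\<dots> = \<psi> (b t)"
      unfolding heis_eq_iff by (simp add: gb(5) \<sigma>_def \<psi>_def algebra_simps)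
    finally show ?thesis using gb(7)[OF t] by simp
  qed
  have AE2: "AE t in lebesgue. t \<in> {0..1} \<longrightarrow> body_velocity \<sigma> t = 2 *\<^sub>R body_velocity \<gamma> t \<and> body_velocity \<gamma> t \<in> V"
  proof -
    have "AE t in lebesgue. t \<notin> S" using gb(3) by (intro AE_not_in) (simp add: negligible_iff_null_sets)
    with AE show ?thesis by eventually_elim (use body \<psi>V in auto)
  qed
  have "\<sigma> \<in> curves_along V 0 ((4 * z) *\<^sub>R Z)"
    unfolding curves_along_def
  proof (intro CollectI conjI)
    show "absolutely_continuous_curve \<sigma>"
      using abs_cont01_linear[OF _ \<psi>] ac(1) by (simp add: absolutely_continuous_curve_iff \<sigma>_def[abs_def])
    show "\<sigma> 0 = 0" "\<sigma> 1 = (4 * z) *\<^sub>R Z" by (simp_all add: \<sigma>_def ac \<psi>_def heis_eq_iff)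
    show "AE t in lebesgue. t \<in> {0..1} \<longrightarrow> body_velocity \<sigma> t \<in> V"
      using AE2 by eventually_elim (auto simp: V_def algebra_simps)
  qed
  moreover have "curve_length N \<sigma> = (\<integral>\<^sup>+ t. ennreal 2 * (ennreal (N (body_velocity \<gamma> t)) * indicator {0..1} t) \<partial>lebesgue)"
    unfolding curve_length_def
  proof (rule nn_integral_cong_AE)
    have "N (2 *\<^sub>R v) = 2 * N v" "0 \<le> N v" if "v \<in> V" for v
      using N that unfolding norm_on_def by auto
    then show "AE t in lebesgue. ennreal (N (body_velocity \<sigma> t)) * indicator {0..1} t =
        ennreal 2 * (ennreal (N (body_velocity \<gamma> t)) * indicator {0..1} t)"
      using AE2 by (elim AE_mp, intro AE_I2 impI) (auto simp: indicator_def ennreal_mult)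
  qed
  moreover have "\<dots> \<le> ennreal 2 * curve_length N \<gamma>"
    unfolding curve_length_def by (rule nn_integral_cmult_le) simp
  ultimately show ?thesis by (intro bexI[of _ \<sigma>]) auto
qed

lemma carnot_scaling:
  "length_distance V N 0 ((4 * z) *\<^sub>R Z) \<le> 2 * length_distance V N 0 (z *\<^sub>R Z)"
proof -
  let ?I = "\<lambda>z. INF \<gamma>\<in>curves_along V 0 (z *\<^sub>R Z). curve_length N \<gamma>"
  have "ennreal (1 / 2) * ?I (4 * z) \<le> ?I z"
  proof (rule INF_greatest)
    fix \<gamma> assume "\<gamma> \<in> curves_along V 0 (z *\<^sub>R Z)"
    then obtain \<sigma> where \<sigma>: "\<sigma> \<in> curves_along V 0 ((4 * z) *\<^sub>R Z)"
      "curve_length N \<sigma> \<le> ennreal 2 * curve_length N \<gamma>" using carnot_dilate by blast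
    have "ennreal (1 / 2) * ?I (4 * z) \<le> ennreal (1 / 2) * (ennreal 2 * curve_length N \<gamma>)"
      using \<sigma> by (intro mult_left_mono INF_lower2[OF \<sigma>(1)]) auto
    also have "\<dots> = curve_length N \<gamma>" by (simp only: mult.assoc[symmetric] ennreal_mult'[symmetric]) simp
    finally show "ennreal (1 / 2) * ?I (4 * z) \<le> curve_length N \<gamma>" .
  qed
  from enn2real_mono[OF this carnot_finite]
  show ?thesis unfolding enn2real_mult length_distance_def by (subst (asm) enn2real_ennreal) auto
qed

end

section \<open>The two distances are not asymptotic\<close>

theorem corollary4p8:
  shows "\<not> (\<exists>d. carnot_metric d \<and>
           ((\<lambda>(p, q). \<bar>d p q - finsler_distance max_norm p q\<bar>) \<longlongrightarrow> 0)
             (filtercomap (\<lambda>(p, q). d p q) at_top))"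
proof
  assume "\<exists>d. carnot_metric d \<and>
           ((\<lambda>(p, q). \<bar>d p q - finsler_distance max_norm p q\<bar>) \<longlongrightarrow> 0)
             (filtercomap (\<lambda>(p, q). d p q) at_top)"
  then obtain s V N where strat: "stratification s V" and N: "norm_on (V 1) N"
    and lim: "((\<lambda>(p, q). \<bar>length_distance (V 1) N p q - finsler_distance max_norm p q\<bar>) \<longlongrightarrow> 0)
             (filtercomap (\<lambda>(p, q). length_distance (V 1) N p q) at_top)"
    unfolding carnot_metric_def by blast
  obtain \<alpha> \<beta> where V: "V 1 = {v. v $ 3 = \<alpha> * v $ 1 + \<beta> * v $ 2}"
    using stratification_first_layer[OF strat] .
  define D where "D z = length_distance (V 1) N 0 (z *\<^sub>R Z)" for z
  define F where "F z = finsler_distance max_norm 0 (z *\<^sub>R Z)" for z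
  have "\<forall>\<^sub>F pq in filtercomap (\<lambda>(p, q). length_distance (V 1) N p q) at_top.
      (\<lambda>(p, q). \<bar>length_distance (V 1) N p q - finsler_distance max_norm p q\<bar>) pq < 1 / 32"
    using lim by (rule order_tendstoD) simp
  then obtain R where R: "\<And>p q. R \<le> length_distance (V 1) N p q \<Longrightarrow>
      \<bar>length_distance (V 1) N p q - finsler_distance max_norm p q\<bar> < 1 / 32"
    unfolding eventually_filtercomap eventually_at_top_linorder by fastforce
  obtain c where c: "0 < c" "\<And>z. 0 \<le> z \<Longrightarrow> c * sqrt z \<le> D z"
    using carnot_lower_bound[OF N[unfolded V]] unfolding V[symmetric] D_def by blast
  \<comment> \<open>Far enough out on the centre for both \<open>D z\<close> and \<open>D (4 * z)\<close> to exceed \<open>R\<close>.\<close>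
  define z where "z = (1 + \<bar>R\<bar> / c)\<^sup>2"
  have "0 \<le> \<bar>R\<bar> / c" using c(1) by simp
  then have sqrt: "sqrt z = 1 + \<bar>R\<bar> / c" and z: "1 \<le> z"
    by (auto simp: z_def one_le_power)
  have "R \<le> c * sqrt z" unfolding sqrt using c(1) by (simp add: distrib_left)
  then have "R \<le> D z" using c(2)[of z] z by linarith
  moreover have "c * sqrt z \<le> c * sqrt (4 * z)" using c(1) z by (intro mult_left_mono) auto
  then have "R \<le> D (4 * z)" using c(2)[of "4 * z"] z \<open>R \<le> c * sqrt z\<close> by linarith
  ultimately have "\<bar>D z - F z\<bar> < 1 / 32" "\<bar>D (4 * z) - F (4 * z)\<bar> < 1 / 32"
    using R unfolding D_def F_def by blast+
  \<comment> \<open>Now \<open>D (4 * z) - F (4 * z)\<close> is at most \<open>2 * (D z - F z) - 1 / 8\<close>, which is below \<open>- 1 / 16\<close>.\<close>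
  moreover have "2 * F z + 1 / 8 \<le> F (4 * z)" unfolding F_def by (rule finsler_gap[OF z])
  moreover have "D (4 * z) \<le> 2 * D z"
    unfolding D_def V by (rule carnot_scaling[OF N[unfolded V]])
  ultimately show False by linarith
qed

end
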